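(* Let $m,n$ be positive integers and let $\rho$ be the sum of $m$ standard representations of $\mathfrak{gl}(n)$ (over $\mathbb{C}$). 1. Assume $m<n$. Write $m=q(n-m)+r$ with $q,r\in\mathbb{Z}$, $0\le r<n-m$. Then the Jordan--Kronecker invariants of $\rho$ are $n(n-m)$ horizontal indices: $q+1$ taken $n(n-m-r)$ times and $q+2$ taken $nr$ times (and there are no other blocks). 2. Assume $m=n$. Then the Jordan--Kronecker invariants of $\rho$ consist of $n$ distinct eigenvalues with $n$ Jordan $1\times 1$ blocks corresponding to each eigenvalue (and there are no other blocks). 3. Assume $m>n$. Write $n=q(m-n)+r$ with $q,r\in\mathbb{Z}$, $0\le r<m-n$. Then the Jordan--Kronecker invariants of $\rho$ are $n(m-n)$ vertical indices: $q+1$ taken $n(m-n-r)$ times and $q+2$ taken $nr$ times (and there are no other blocks).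
   Context: Everything is over $\mathbb{C}$ and finite-dimensional. Pencils. For linear maps $A,B:U\to V$ there are bases of $U$ and $V$ (Kronecker's theorem) in which all matrices $A+\lambda B$ are simultaneously block-diagonal, each pair of diagonal blocks $(A_i,B_i)$ being one of: (i) a $k\times k$ Jordan block with eigenvalue $\lambda_0\in\mathbb{C}$: $A_i=J_k(\lambda_0)$ (the upper triangular Jordan block), $B_i=I_k$; (ii) a $k\times k$ Jordan block with eigenvalue $\infty$: $A_i=I_k$, $B_i=J_k(0)$; (iii) a horizontal Kronecker block of size $(h-1)\times h$, $h\ge 1$: $A_i=(0\,|\,I_{h-1})$, $B_i=(I_{h-1}\,|\,0)$; (iv) a vertical Kronecker block of size $v\times(v-1)$, $v\ge1$: the transposes of the matrices in (iii) with $h=v$. A $0\times 1$ horizontal block ($h=1$) is a zero column and a $1\times 0$ vertical block ($v=1$) is a zero row. The blocks are unique up to permutation. The numbers $h$ (widths of horizontal blocks) are the horizontal indices, the numbers $v$ (heights of vertical blocks) are the vertical indices. Representations. For a representation $\rho:\mathfrak{g}\to\mathfrak{gl}(V)$ and $x\in V$ put $R_x:\mathfrak{g}\to V$, $R_x(\xi)=\rho(\xi)x$. The algebraic type of the pencil $R_a+\lambda R_b=R_{a+\lambda b}$ is the collection: number of distinct eigenvalues of Jordan blocks, number and sizes of the Jordan blocks for each eigenvalue, horizontal and vertical indices (with multiplicity). The Jordan--Kronecker (JK) invariants of $\rho$ are the algebraic type of $R_{a+\lambda b}$ for a generic pair $(a,b)\in V\times V$ (i.e. for all pairs in some non-empty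 Zariski open subset). The sum of $m$ standard representations of a matrix Lie algebra $\mathfrak{g}\subset\mathfrak{gl}(n)$ is the representation on $n\times m$ matrices given by $\rho(Y)X=YX$, $Y\in\mathfrak{g}$, $X\in\mathrm{Mat}_{n\times m}$. *)

theory Defs
  imports
    "Jordan_Normal_Form.Jordan_Normal_Form"
    "Jordan_Normal_Form.VS_Connect"
    "HOL-Library.Multiset"
begin

section \<open>Matrices of linear maps\<close>

definition ordered_basis :: "(complex, 'v) module \<Rightarrow> 'v list \<Rightarrow> bool" where
  "ordered_basis V vs \<longleftrightarrow> distinct vs \<and> vectorspace.basis class_ring V (set vs)"

definition is_matrix_of ::
  "'u list \<Rightarrow> (complex, 'v) module \<Rightarrow> 'v list \<Rightarrow> ('u \<Rightarrow> 'v) \<Rightarrow> complex mat \<Rightarrow> bool" where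
  "is_matrix_of us V vs f M \<longleftrightarrow>
     M \<in> carrier_mat (length vs) (length us) \<and>
     (\<forall>j < length us. f (us ! j) = (\<Oplus>\<^bsub>V\<^esub> i \<in> {..<length vs}. M $$ (i, j) \<odot>\<^bsub>V\<^esub> vs ! i))"

section \<open>Kronecker canonical form and algebraic type of a pencil\<close>

datatype eigenvalue = Finite complex | Infinite

datatype pencil_block = Jordan eigenvalue nat | Horizontal nat | Vertical nat

text \<open>\<open>Jordan e k\<close> is a \<open>k \<times> k\<close> Jordan block with eigenvalue \<open>e\<close>, \<open>Horizontal h\<close> a Kronecker
  block of size \<open>(h - 1) \<times> h\<close>, and \<open>Vertical v\<close> one of size \<open>v \<times> (v - 1)\<close>.\<close>

fun block_size :: "pencil_block \<Rightarrow> nat" where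
  "block_size (Jordan e k) = k"
| "block_size (Horizontal h) = h"
| "block_size (Vertical v) = v"

text \<open>The diagonal blocks of \<open>A\<close> (\<open>block_fst\<close>) and \<open>B\<close> (\<open>block_snd\<close>) in the pencil \<open>A + \<lambda>B\<close>;
  the horizontal blocks are \<open>(0 | I)\<close> and \<open>(I | 0)\<close>.\<close>

fun block_fst :: "pencil_block \<Rightarrow> complex mat" where
  "block_fst (Jordan (Finite c) k) = jordan_block k c"
| "block_fst (Jordan Infinite k) = 1\<^sub>m k"
| "block_fst (Horizontal h) = mat (h - 1) h (\<lambda>(i, j). if j = Suc i then 1 else 0)"
| "block_fst (Vertical v) = transpose_mat (mat (v - 1) v (\<lambda>(i, j). if j = Suc i then 1 else 0))"

fun block_snd :: "pencil_block \<Rightarrow> complex mat" where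
  "block_snd (Jordan (Finite c) k) = 1\<^sub>m k"
| "block_snd (Jordan Infinite k) = jordan_block k 0"
| "block_snd (Horizontal h) = mat (h - 1) h (\<lambda>(i, j). if j = i then 1 else 0)"
| "block_snd (Vertical v) = transpose_mat (mat (v - 1) v (\<lambda>(i, j). if j = i then 1 else 0))"

text \<open>The values of the eigenvalues are forgotten: \<open>jordan_sizes\<close> has one element for each distinct
  eigenvalue (infinity included), namely the multiset of the sizes of its Jordan blocks.\<close>

record algebraic_type =
  jordan_sizes :: "nat multiset multiset"
  horizontal_indices :: "nat multiset"
  vertical_indices :: "nat multiset"

definition eigenvalues_of :: "pencil_block list \<Rightarrow> eigenvalue set" where
  "eigenvalues_of bs = {e. \<exists>k. Jordan e k \<in> set bs}"

definition type_of_blocks :: "pencil_block list \<Rightarrow> algebraic_type" where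
  "type_of_blocks bs =
     \<lparr> jordan_sizes =
         image_mset (\<lambda>e. mset [k. Jordan e' k \<leftarrow> bs, e' = e]) (mset_set (eigenvalues_of bs)),
       horizontal_indices = mset [h. Horizontal h \<leftarrow> bs],
       vertical_indices = mset [v. Vertical v \<leftarrow> bs] \<rparr>"

text \<open>By Kronecker's theorem there is exactly one \<open>T\<close> with \<open>has_algebraic_type U V A B T\<close> for
  linear maps \<open>A, B\<close> between finite-dimensional spaces \<open>U, V\<close>.  Blocks of size 0 are excluded;
  \<open>Horizontal 1\<close> is a zero column and \<open>Vertical 1\<close> a zero row.\<close>

definition has_algebraic_type ::
  "(complex, 'u) module \<Rightarrow> (complex, 'v) module \<Rightarrow> ('u \<Rightarrow> 'v) \<Rightarrow> ('u \<Rightarrow> 'v) \<Rightarrow>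
     algebraic_type \<Rightarrow> bool" where
  "has_algebraic_type U V A B T \<longleftrightarrow>
     (\<exists>us vs bs. ordered_basis U us \<and> ordered_basis V vs \<and>
        (\<forall>b \<in> set bs. 1 \<le> block_size b) \<and>
        is_matrix_of us V vs A (diag_block_mat (map block_fst bs)) \<and>
        is_matrix_of us V vs B (diag_block_mat (map block_snd bs)) \<and>
        type_of_blocks bs = T)"

section \<open>Zariski open sets\<close>

text \<open>Polynomial functions on a vector space are generated by the constants and the linear
  functionals; their values outside the carrier are irrelevant.\<close>

inductive_set polynomial_functions :: "(complex, 'v) module \<Rightarrow> ('v \<Rightarrow> complex) set"
  for V :: "(complex, 'v) module" where
  const: "(\<lambda>_. c) \<in> polynomial_functions V"
| linear: "(\<And>x y. x \<in> carrier V \<Longrightarrow> y \<in> carrier V \<Longrightarrow> f (x \<oplus>\<^bsub>V\<^esub> y) = f x + f y) \<Longrightarrow>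
    (\<And>c x. x \<in> carrier V \<Longrightarrow> f (c \<odot>\<^bsub>V\<^esub> x) = c * f x) \<Longrightarrow> f \<in> polynomial_functions V"
| add: "f \<in> polynomial_functions V \<Longrightarrow> g \<in> polynomial_functions V \<Longrightarrow>
    (\<lambda>x. f x + g x) \<in> polynomial_functions V"
| mult: "f \<in> polynomial_functions V \<Longrightarrow> g \<in> polynomial_functions V \<Longrightarrow>
    (\<lambda>x. f x * g x) \<in> polynomial_functions V"

definition zariski_open :: "(complex, 'v) module \<Rightarrow> 'v set \<Rightarrow> bool" where
  "zariski_open V S \<longleftrightarrow>
     (\<exists>F \<subseteq> polynomial_functions V. S = {x \<in> carrier V. \<exists>f \<in> F. f x \<noteq> 0})"

section \<open>Jordan--Kronecker invariants\<close>

definition orbit_map :: "('g \<Rightarrow> 'v \<Rightarrow> 'v) \<Rightarrow> 'v \<Rightarrow> 'g \<Rightarrow> 'v" where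
  "orbit_map \<rho> x = (\<lambda>\<xi>. \<rho> \<xi> x)"

text \<open>Two non-empty Zariski open sets of a vector space intersect, so at most one \<open>T\<close> satisfies
  this relation.\<close>

definition has_JK_invariants ::
  "(complex, 'g) module \<Rightarrow> (complex, 'v) module \<Rightarrow> ('g \<Rightarrow> 'v \<Rightarrow> 'v) \<Rightarrow>
     algebraic_type \<Rightarrow> bool" where
  "has_JK_invariants G V \<rho> T \<longleftrightarrow>
     (\<exists>S. S \<noteq> {} \<and> zariski_open (direct_sum V V) S \<and>
        (\<forall>(a, b) \<in> S. has_algebraic_type G V (orbit_map \<rho> a) (orbit_map \<rho> b) T))"

abbreviation Mat :: "nat \<Rightarrow> nat \<Rightarrow> (complex, complex mat) module" where
  "Mat n m \<equiv> module_mat TYPE(complex) n m"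

abbreviation gl :: "nat \<Rightarrow> (complex, complex mat) module" where
  "gl n \<equiv> Mat n n"

text \<open>The number \<open>m\<close> of copies enters only through the representation space \<open>Mat n m\<close>.\<close>

definition standard_rep_sum :: "complex mat \<Rightarrow> complex mat \<Rightarrow> complex mat" where
  "standard_rep_sum Y X = Y * X"

lemma vectorspace_Mat: "vectorspace class_ring (Mat n m)"
proof -
  interpret matrix_vs n m "TYPE(complex)" .
  show ?thesis by (rule vectorspace_axioms)
qed

lemma standard_rep_sum_linear_map:
  assumes "X \<in> carrier (Mat n m)"
  shows "linear_map class_ring (gl n) (Mat n m) (orbit_map standard_rep_sum X)"
  using assms vectorspace_Mat[of n n] vectorspace_Mat[of n m]
  unfolding linear_map_def mod_hom_def mod_hom_axioms_def vectorspace_def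
  by (auto simp: module_hom_def module_mat_simps orbit_map_def standard_rep_sum_def
      intro!: add_mult_distrib_mat)

lemma standard_rep_sum_commutator:
  assumes "Y \<in> carrier (gl n)" "Z \<in> carrier (gl n)" "X \<in> carrier (Mat n m)"
  shows "standard_rep_sum (Y * Z - Z * Y) X =
    standard_rep_sum Y (standard_rep_sum Z X) - standard_rep_sum Z (standard_rep_sum Y X)"
  using assms unfolding standard_rep_sum_def module_mat_simps
  by (simp add: minus_mult_distrib_mat[of _ n n] assoc_mult_mat[of _ n n _ n _ m])

end

(* Row by row, Y X is n copies of the pencil of transposes A^T + l B^T, so it suffices to find the
   Kronecker form of a generic m x n pencil. For m > n this is the transpose of the wide case.

   Wide case, by induction on q: if (A; B) is injective, its cokernel is a pencil (N1, N2) with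
   N1 B = N2 A, and when (N1, N2) has horizontal blocks of widths h, the pencil (A, B) has
   horizontal blocks of widths h + 1. Given auxiliary matrices L1, L2, E1, E2 with
   D = L1 B + L2 A invertible, the rows (E2, E1) - (E2 A + E1 B) D^-1 (L2, L1) annihilate (A; B);
   multiplied by det D they are polynomial in (A, B), so genericity passes from N to (A, B).
   All widths are 1 or 2 in the base case q = 0.

   Square case: B^-1 A has distinct eigenvalues if and only if the Hankel determinant of the
   traces of its powers is non-zero. *)
theory Submission
  imports Defs "Jordan_Normal_Form.Jordan_Normal_Form_Existence"
begin

section \<open>Copies of a pencil\<close>

text \<open>The stacked matrix \<open>(A; B)\<close> of an m x (m + d) pencil has 2m rows and m + d
  columns, so its cokernel is an (m - d) x m pencil with the same excess d. Passing to it is one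
  step of the Euclidean division of m by d: q drops by one, and the descent ends with r < d rows,
  where the 2r rows of A and B fit into r + d columns and are generically independent. This is why
  only the widths q + 1 and q + 2 occur.

  A cokernel has no canonical basis, so it is not by itself a polynomial function of the pencil. The
  auxiliary matrices fix a choice, and a generic condition may quantify existentially over them
  because any union of open sets is open. The shape of the pencil changes at every step while the
  space of pairs (a, b) stays the same; therefore openness is required of pullbacks along polynomial
  families and not of subsets of one matrix space.\<close>

definition mutually_inverse :: "nat \<Rightarrow> complex mat \<Rightarrow> complex mat \<Rightarrow> bool" where
  "mutually_inverse n P P' \<longleftrightarrow>
     P \<in> carrier_mat n n \<and> P' \<in> carrier_mat n n \<and> P * P' = 1\<^sub>m n \<and> P' * P = 1\<^sub>m n"

text \<open>The columns of \<open>Q\<close> and \<open>P\<close> are the new bases of source and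
  target. The carrier conditions have content: the two product equations alone do not determine the
  number of rows of the block-diagonal matrices.\<close>

definition pencil_equiv ::
  "nat \<Rightarrow> nat \<Rightarrow> complex mat \<Rightarrow> complex mat \<Rightarrow> pencil_block list \<Rightarrow> bool" where
  "pencil_equiv m n A B bs \<longleftrightarrow>
     (\<exists>P P' Q Q'. mutually_inverse m P P' \<and> mutually_inverse n Q Q' \<and>
        diag_block_mat (map block_fst bs) \<in> carrier_mat m n \<and>
        diag_block_mat (map block_snd bs) \<in> carrier_mat m n \<and>
        A * Q = P * diag_block_mat (map block_fst bs) \<and>
        B * Q = P * diag_block_mat (map block_snd bs))"

lemma mutually_inverse_sym: "mutually_inverse n P P' \<Longrightarrow> mutually_inverse n P' P"
  by (auto simp: mutually_inverse_def)

lemma mutually_inverseI: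
  assumes "P \<in> carrier_mat n n" "P' \<in> carrier_mat n n" "P * P' = 1\<^sub>m n"
  shows "mutually_inverse n P P'"
  using assms mat_mult_left_right_inverse[of P n P'] by (auto simp: mutually_inverse_def)

section \<open>Entrywise formulas for products and finite sums of matrices\<close>

lemma mat_mult_index_sum:
  assumes "A \<in> carrier_mat p q" "B \<in> carrier_mat q r" "i < p" "j < r"
  shows "(A * B) $$ (i, j) = (\<Sum>k<q. A $$ (i, k) * B $$ (k, j))"
  using assms by (auto simp: scalar_prod_def lessThan_atLeast0)

lemma sum_div_mod:
  fixes f :: "nat \<Rightarrow> nat \<Rightarrow> 'a::comm_monoid_add"
  shows "(\<Sum>I<N * p. f (I div p) (I mod p)) = (\<Sum>i<N. \<Sum>k<p. f i k)"
proof -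
  have "(\<Sum>I<N * p. f (I div p) (I mod p)) = (\<Sum>i<N. \<Sum>I\<in>{i * p..<i * p + p}. f (I div p) (I mod p))"
    by (rule sum.nat_group[symmetric])
  also have "\<dots> = (\<Sum>i<N. \<Sum>k<p. f i k)"
  proof (rule sum.cong[OF refl])
    fix i
    have "(\<Sum>I\<in>{i * p..<i * p + p}. f (I div p) (I mod p)) =
        (\<Sum>k\<in>{0..<p}. f ((k + i * p) div p) ((k + i * p) mod p))"
      using sum.shift_bounds_nat_ivl[of "\<lambda>I. f (I div p) (I mod p)" 0 "i * p" p]
      by (simp add: add.commute)
    then show "(\<Sum>I\<in>{i * p..<i * p + p}. f (I div p) (I mod p)) = (\<Sum>k<p. f i k)"
      by (simp add: lessThan_atLeast0)
  qed
  finally show ?thesis .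
qed

lemma finsum_Mat:
  assumes "finite S" "f \<in> S \<rightarrow> carrier_mat N p"
  shows "(\<Oplus>\<^bsub>Mat N p\<^esub> s \<in> S. f s) \<in> carrier_mat N p"
    and "i < N \<Longrightarrow> j < p \<Longrightarrow> (\<Oplus>\<^bsub>Mat N p\<^esub> s \<in> S. f s) $$ (i, j) = (\<Sum>s\<in>S. f s $$ (i, j))"
proof -
  interpret matrix_vs N p "TYPE(complex)" .
  have "(\<Oplus>\<^bsub>V\<^esub> s \<in> S. f s) \<in> carrier_mat N p \<and>
    (\<forall>i<N. \<forall>j<p. (\<Oplus>\<^bsub>V\<^esub> s \<in> S. f s) $$ (i, j) = (\<Sum>s\<in>S. f s $$ (i, j)))"
    using assms
  proof (induction S rule: finite_induct)
    case empty
    then show ?case by simp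
  next
    case (insert x S)
    then have fS: "f \<in> S \<rightarrow> carrier_mat N p" "f x \<in> carrier_mat N p" by auto
    have e: "finsum V f (insert x S) = f x + finsum V f S"
      using insert fS by (simp add: finsum_insert)
    have c: "finsum V f S \<in> carrier_mat N p" using insert fS by blast
    have "(f x + finsum V f S) $$ (i, j) = f x $$ (i, j) + finsum V f S $$ (i, j)"
      if "i < N" "j < p" for i j
      using c that by (intro index_add_mat(1)) (simp_all only: carrier_matD[OF c])
    with insert fS c show ?case
      unfolding e by (simp del: index_add_mat)
  qed
  then show "(\<Oplus>\<^bsub>Mat N p\<^esub> s \<in> S. f s) \<in> carrier_mat N p"
    and "i < N \<Longrightarrow> j < p \<Longrightarrow> (\<Oplus>\<^bsub>Mat N p\<^esub> s \<in> S. f s) $$ (i, j) = (\<Sum>s\<in>S. f s $$ (i, j))"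
    by auto
qed

text \<open>The matrices with exactly one non-zero row, which is a column of \<open>P\<close>; the element
  number \<open>i * p + k\<close> has column \<open>k\<close> of \<open>P\<close> as row \<open>i\<close>.\<close>

definition row_basis :: "nat \<Rightarrow> nat \<Rightarrow> complex mat \<Rightarrow> complex mat list" where
  "row_basis N p P =
     map (\<lambda>I. mat N p (\<lambda>(i, j). if i = I div p then P $$ (j, I mod p) else 0)) [0..<N * p]"

lemma length_row_basis [simp]: "length (row_basis N p P) = N * p"
  by (simp add: row_basis_def)

lemma nth_row_basis:
  "I < N * p \<Longrightarrow> row_basis N p P ! I =
     mat N p (\<lambda>(i, j). if i = I div p then P $$ (j, I mod p) else 0)"
  unfolding row_basis_def by (simp only: nth_map length_upt diff_zero nth_upt add_0)

text \<open>Only the p basis matrices supported on row i contribute to row i, so that row is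
  \<open>P\<close> applied to the i-th segment of length p of the coefficients.\<close>

lemma finsum_row_basis:
  assumes "P \<in> carrier_mat p p"
  shows "(\<Oplus>\<^bsub>Mat N p\<^esub> I \<in> {..<N * p}. c I \<odot>\<^bsub>Mat N p\<^esub> row_basis N p P ! I) =
    mat N p (\<lambda>(i, j). \<Sum>k<p. c (i * p + k) * P $$ (j, k))" (is "?S = ?M")
proof (rule eq_matI)
  have f: "(\<lambda>I. c I \<odot>\<^bsub>Mat N p\<^esub> row_basis N p P ! I) \<in> {..<N * p} \<rightarrow> carrier_mat N p"
    by (auto simp: nth_row_basis module_mat_simps)
  have S: "?S \<in> carrier_mat N p"
    by (rule finsum_Mat(1)[OF _ f]) simp
  then show "dim_row ?S = dim_row ?M" "dim_col ?S = dim_col ?M" by auto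
  fix i j assume "i < dim_row ?M" "j < dim_col ?M"
  then have ij: "i < N" "j < p" by auto
  have "?S $$ (i, j) = (\<Sum>I<N * p. (c I \<odot>\<^bsub>Mat N p\<^esub> row_basis N p P ! I) $$ (i, j))"
    by (rule finsum_Mat(2)[OF _ f]) (use ij in auto)
  also have "\<dots> = (\<Sum>I<N * p. if I div p = i
      then c (I div p * p + I mod p) * P $$ (j, I mod p) else 0)"
    by (rule sum.cong) (use ij in \<open>auto simp: nth_row_basis module_mat_simps\<close>)
  also have "\<dots> = (\<Sum>i'<N. \<Sum>k<p. if i' = i then c (i' * p + k) * P $$ (j, k) else 0)"
    by (rule sum_div_mod[of "\<lambda>i' k. if i' = i then c (i' * p + k) * P $$ (j, k) else 0"])
  also have "\<dots> = (\<Sum>i'<N. if i' = i then (\<Sum>k<p. c (i * p + k) * P $$ (j, k)) else 0)"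
    by (rule sum.cong) auto
  also have "\<dots> = ?M $$ (i, j)" using ij by simp
  finally show "?S $$ (i, j) = ?M $$ (i, j)" .
qed

text \<open>Dual functionals replace any dimension count: applying \<open>\<phi> k\<close> to a
  vanishing combination isolates one coefficient, which gives independence, and the expansion gives
  spanning.\<close>

lemma ordered_basis_by_coordinates:
  assumes V: "vectorspace class_ring V"
    and vs: "set vs \<subseteq> carrier V"
    and add: "\<And>k x y. k < length vs \<Longrightarrow> x \<in> carrier V \<Longrightarrow> y \<in> carrier V \<Longrightarrow>
      \<phi> k (x \<oplus>\<^bsub>V\<^esub> y) = \<phi> k x + \<phi> k y"
    and smult: "\<And>k c x. k < length vs \<Longrightarrow> x \<in> carrier V \<Longrightarrow> \<phi> k (c \<odot>\<^bsub>V\<^esub> x) = c * \<phi> k x"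
    and dual: "\<And>k l. k < length vs \<Longrightarrow> l < length vs \<Longrightarrow> \<phi> k (vs ! l) = (if k = l then 1 else 0)"
    and expand: "\<And>x. x \<in> carrier V \<Longrightarrow> x = (\<Oplus>\<^bsub>V\<^esub> k \<in> {..<length vs}. \<phi> k x \<odot>\<^bsub>V\<^esub> vs ! k)"
  shows "ordered_basis V vs"
proof -
  interpret vectorspace class_ring V by (rule V)
  have dist: "distinct vs"
    unfolding distinct_conv_nth by (metis dual zero_neq_one)
  have zero: "\<phi> k \<zero>\<^bsub>V\<^esub> = 0" if "k < length vs" for k
    using add[OF that, of "\<zero>\<^bsub>V\<^esub>" "\<zero>\<^bsub>V\<^esub>"] by simp
  have sum: "\<phi> k (\<Oplus>\<^bsub>V\<^esub> s \<in> S. f s) = (\<Sum>s\<in>S. \<phi> k (f s))"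
    if "k < length vs" "finite S" "f \<in> S \<rightarrow> carrier V" for k f and S :: "'a set"
    using that(2,3)
  proof (induction S rule: finite_induct)
    case (insert x S)
    then have "f \<in> S \<rightarrow> carrier V" "f x \<in> carrier V" by auto
    with insert show ?case
      by (simp add: add[OF that(1)])
  qed (simp add: zero that)
  have "lin_indpt (set vs)"
  proof
    assume "lin_dep (set vs)"
    then obtain A a v where A: "finite A" "A \<subseteq> set vs" "lincomb a A = \<zero>\<^bsub>V\<^esub>" "v \<in> A" "a v \<noteq> 0"
      unfolding lin_dep_def by auto
    then obtain k where k: "k < length vs" "v = vs ! k" by (metis in_set_conv_nth subsetD)
    have "0 = \<phi> k (\<Oplus>\<^bsub>V\<^esub> s \<in> A. a s \<odot>\<^bsub>V\<^esub> s)"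
      using A(3) zero[OF k(1)] by (simp add: lincomb_def)
    also have "\<dots> = (\<Sum>s\<in>A. \<phi> k (a s \<odot>\<^bsub>V\<^esub> s))"
      using A vs by (intro sum k) auto
    also have "\<dots> = (\<Sum>s\<in>A. if s = v then a s else 0)"
    proof (rule sum.cong[OF refl])
      fix s assume "s \<in> A"
      then obtain l where l: "l < length vs" "s = vs ! l" using A by (metis in_set_conv_nth subsetD)
      have "s \<in> carrier V" using \<open>s \<in> A\<close> A vs by auto
      then show "\<phi> k (a s \<odot>\<^bsub>V\<^esub> s) = (if s = v then a s else 0)"
        using smult[OF k(1), of s "a s"] dual[OF k(1) l(1)] l k dist
        by (auto simp: nth_eq_iff_index_eq)
    qed
    also have "\<dots> = a v" using A by simp
    finally show False using A by simp
  qed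
  moreover have "gen_set (set vs)"
  proof
    show "span (set vs) \<subseteq> carrier V" using vs by (rule span_is_subset2)
    show "carrier V \<subseteq> span (set vs)"
    proof
      fix x assume x: "x \<in> carrier V"
      \<comment> \<open>\<open>lincomb\<close> sums over a set of vectors, so the coefficients,
        given by position in the list, are carried over through the inverse of the indexing
        map.\<close>
      define a where "a v = \<phi> (the_inv_into {..<length vs} ((!) vs) v) x" for v
      have inj: "inj_on ((!) vs) {..<length vs}"
        using dist by (simp add: inj_on_nth)
      have "x = (\<Oplus>\<^bsub>V\<^esub> k \<in> {..<length vs}. a (vs ! k) \<odot>\<^bsub>V\<^esub> vs ! k)"
      proof (subst expand[OF x], rule finsum_cong')
        show "(\<lambda>k. a (vs ! k) \<odot>\<^bsub>V\<^esub> vs ! k) \<in> {..<length vs} \<rightarrow> carrier V"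
          using vs by (auto intro!: smult_closed)
      qed (simp_all add: a_def the_inv_into_f_f[OF inj])
      also have "\<dots> = (\<Oplus>\<^bsub>V\<^esub> v \<in> (!) vs ` {..<length vs}. a v \<odot>\<^bsub>V\<^esub> v)"
        using vs inj by (intro finsum_reindex[symmetric]) (auto intro!: smult_closed)
      also have "(!) vs ` {..<length vs} = set vs"
        by (auto simp: set_conv_nth)
      finally have "x = lincomb a (set vs)"
        by (simp add: lincomb_def)
      then show "x \<in> span (set vs)"
        unfolding span_def by auto
    qed
  qed
  ultimately show ?thesis
    using dist vs by (auto simp: ordered_basis_def basis_def)
qed

text \<open>The coordinate with number I of \<open>X\<close> is the entry (I mod p, I div p) of
  \<open>P'\<close> times the transpose of \<open>X\<close>. Duality is then
  \<open>P' * P = 1\<close> and the expansion is \<open>P * P' = 1\<close>.\<close>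

lemma ordered_basis_row_basis:
  assumes "mutually_inverse p P P'"
  shows "ordered_basis (Mat N p) (row_basis N p P)"
proof (rule ordered_basis_by_coordinates[OF vectorspace_Mat,
    where \<phi> = "\<lambda>I X. \<Sum>j<p. P' $$ (I mod p, j) * X $$ (I div p, j)"], goal_cases)
  case 1
  then show ?case by (auto simp: row_basis_def module_mat_simps)
next
  case (2 I X Y)
  then have "I div p < N" by (simp add: less_mult_imp_div_less)
  with 2 show ?case
    by (simp add: module_mat_simps distrib_left sum.distrib)
next
  case (3 I c X)
  then have "I div p < N" by (simp add: less_mult_imp_div_less)
  with 3 show ?case
    by (simp add: module_mat_simps sum_distrib_left mult.left_commute)
next
  case (4 I J)
  then have p: "p > 0" by (cases p) auto
  from 4 have IJ: "I div p < N" "J div p < N" "I mod p < p" "J mod p < p"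
    using p by (auto simp: less_mult_imp_div_less)
  have P: "P \<in> carrier_mat p p" "P' \<in> carrier_mat p p" "P' * P = 1\<^sub>m p"
    using assms by (auto simp: mutually_inverse_def)
  have "(\<Sum>j<p. P' $$ (I mod p, j) * row_basis N p P ! J $$ (I div p, j)) =
      (if I div p = J div p then (\<Sum>j<p. P' $$ (I mod p, j) * P $$ (j, J mod p)) else 0)"
    using IJ 4 by (auto simp: nth_row_basis)
  also have "\<dots> = (if I div p = J div p then (P' * P) $$ (I mod p, J mod p) else 0)"
    using mat_mult_index_sum[OF P(2,1) IJ(3,4)] by simp
  also have "\<dots> = (if I = J then 1 else 0)"
    using IJ unfolding P(3) by (auto, metis div_mult_mod_eq)
  finally show ?case .
next
  case (5 X)
  then have X: "X \<in> carrier_mat N p" by (simp add: module_mat_simps)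
  have P: "P \<in> carrier_mat p p" "P' \<in> carrier_mat p p" "P * P' = 1\<^sub>m p"
    using assms by (auto simp: mutually_inverse_def)
  have *: "(\<Sum>k<p. (\<Sum>l<p. P' $$ (k, l) * X $$ (i, l)) * P $$ (j, k)) = X $$ (i, j)"
    if "i < N" "j < p" for i j
  proof -
    have "(\<Sum>k<p. (\<Sum>l<p. P' $$ (k, l) * X $$ (i, l)) * P $$ (j, k)) =
      (\<Sum>k<p. P $$ (j, k) * (P' * transpose_mat X) $$ (k, i))"
      using that X P
      by (intro sum.cong refl)
        (simp add: mat_mult_index_sum[of _ p p _ N] mult.commute del: index_mult_mat)
    also have "\<dots> = (P * (P' * transpose_mat X)) $$ (j, i)"
      using that X P by (intro mat_mult_index_sum[of _ p p _ N, symmetric]) auto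
    also have "P * (P' * transpose_mat X) = transpose_mat X"
      using X P by (subst assoc_mult_mat[symmetric, of _ p p _ p _ N]) auto
    finally show ?thesis using that X by simp
  qed
  show ?case unfolding length_row_basis
    by (subst finsum_row_basis[OF P(1)], rule eq_matI) (use X * in auto)
qed

section \<open>Block-diagonal matrices with equal blocks, and the orbit map\<close>

lemma diag_block_mat_replicate:
  assumes "K \<in> carrier_mat p n"
  shows "diag_block_mat (replicate N K) =
    mat (N * p) (N * n) (\<lambda>(I, J). if I div p = J div n then K $$ (I mod p, J mod n) else 0)"
proof (induction N)
  case 0
  then show ?case by auto
next
  case (Suc N)
  have div: "I div k = Suc ((I - k) div k)" and mod: "I mod k = (I - k) mod k"
    if "k \<le> I" "I < k + N * k" for I k :: nat
    using that by (cases "k = 0"; simp add: le_div_geq le_mod_geq)+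
  show ?case
    by (rule eq_matI) (use assms in \<open>auto simp: Suc Let_def not_less div mod\<close>)
qed

lemma diag_block_mat_concat_replicate:
  "diag_block_mat (concat (replicate N As)) = diag_block_mat (replicate N (diag_block_mat As))"
  by (induction N) (simp_all add: diag_block_mat_append Let_def)

text \<open>Right multiplication by \<open>A\<close> does not mix rows, and on a single row written
  as a column it is the transpose of \<open>A\<close>. A column of \<open>Q\<close> placed in row i
  thus goes to a column of \<open>P * K\<close> in the same row, whose coefficients in the columns
  of \<open>P\<close> are a column of \<open>K\<close>.\<close>

lemma is_matrix_of_row_basis:
  assumes A: "A \<in> carrier_mat n m" and P: "P \<in> carrier_mat m m" and Q: "Q \<in> carrier_mat n n"
    and K: "K \<in> carrier_mat m n" and eq: "transpose_mat A * Q = P * K"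
  shows "is_matrix_of (row_basis N n Q) (Mat N m) (row_basis N m P)
    (orbit_map standard_rep_sum A) (diag_block_mat (replicate N K))"
  unfolding is_matrix_of_def length_row_basis
proof (intro conjI allI impI)
  show "diag_block_mat (replicate N K) \<in> carrier_mat (N * m) (N * n)"
    by (simp add: diag_block_mat_replicate[OF K])
  fix J assume J: "J < N * n"
  then have "n > 0" by (cases n) auto
  then have J': "J div n < N" "J mod n < n"
    using J by (auto simp: less_mult_imp_div_less)
  have lt: "i * m + k < N * m" if "i < N" "k < m" for i k
  proof -
    have "i * m + k < Suc i * m" using that by simp
    also have "\<dots> \<le> N * m" using that by (intro mult_le_mono1) auto
    finally show ?thesis .
  qed
  show "orbit_map standard_rep_sum A (row_basis N n Q ! J) =
    (\<Oplus>\<^bsub>Mat N m\<^esub>I\<in>{..<N * m}. diag_block_mat (replicate N K) $$ (I, J) \<odot>\<^bsub>Mat N m\<^esub> row_basis N m P ! I)"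
    (is "?L = _")
  proof (subst finsum_row_basis[OF P], rule eq_matI, goal_cases)
    case (1 i j)
    then have ij: "i < N" "j < m" by auto
    have "?L $$ (i, j) = (\<Sum>l<n. row_basis N n Q ! J $$ (i, l) * A $$ (l, j))"
      unfolding orbit_map_def standard_rep_sum_def
      by (rule mat_mult_index_sum[OF _ A]) (use ij J in \<open>auto simp: nth_row_basis\<close>)
    also have "\<dots> = (if i = J div n then \<Sum>l<n. Q $$ (l, J mod n) * A $$ (l, j) else 0)"
      using ij J by (simp add: nth_row_basis)
    also have "(\<Sum>l<n. Q $$ (l, J mod n) * A $$ (l, j)) = (transpose_mat A * Q) $$ (j, J mod n)"
      using A Q ij J' by (subst mat_mult_index_sum[of _ m n _ n]) (auto simp: mult.commute)
    also have "\<dots> = (\<Sum>k<m. K $$ (k, J mod n) * P $$ (j, k))"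
      unfolding eq using P K ij J' by (subst mat_mult_index_sum[of _ m m _ n]) (auto simp: mult.commute)
    finally show ?case
      using ij J lt by (auto simp: diag_block_mat_replicate[OF K])
  qed (use A J in \<open>auto simp: orbit_map_def standard_rep_sum_def nth_row_basis\<close>)
qed

lemma has_algebraic_type_copies:
  assumes A: "A \<in> carrier_mat n m" and B: "B \<in> carrier_mat n m"
    and size: "\<forall>b \<in> set bs. 1 \<le> block_size b"
    and equiv: "pencil_equiv m n (transpose_mat A) (transpose_mat B) bs"
  shows "has_algebraic_type (gl n) (Mat n m) (orbit_map standard_rep_sum A)
    (orbit_map standard_rep_sum B) (type_of_blocks (concat (replicate n bs)))"
proof -
  obtain P P' Q Q' where inv: "mutually_inverse m P P'" "mutually_inverse n Q Q'"
    and c: "diag_block_mat (map block_fst bs) \<in> carrier_mat m n"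
      "diag_block_mat (map block_snd bs) \<in> carrier_mat m n"
    and eq: "transpose_mat A * Q = P * diag_block_mat (map block_fst bs)"
      "transpose_mat B * Q = P * diag_block_mat (map block_snd bs)"
    using equiv unfolding pencil_equiv_def by blast
  have PQ: "P \<in> carrier_mat m m" "Q \<in> carrier_mat n n"
    using inv by (auto simp: mutually_inverse_def)
  show ?thesis
    unfolding has_algebraic_type_def
    using ordered_basis_row_basis[OF inv(1)] ordered_basis_row_basis[OF inv(2)] size
      is_matrix_of_row_basis[OF A PQ c(1) eq(1)] is_matrix_of_row_basis[OF B PQ c(2) eq(2)]
    by (intro exI[of _ "row_basis n n Q"] exI[of _ "row_basis n m P"]
        exI[of _ "concat (replicate n bs)"])
      (auto simp: map_concat map_replicate diag_block_mat_concat_replicate)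
qed

section \<open>Polynomial families of matrices\<close>

lemma polynomial_functions_cong:
  assumes "f \<in> polynomial_functions V" "\<And>x. x \<in> carrier V \<Longrightarrow> g x = f x"
    and closed: "\<And>x y. x \<in> carrier V \<Longrightarrow> y \<in> carrier V \<Longrightarrow> x \<oplus>\<^bsub>V\<^esub> y \<in> carrier V"
      "\<And>c x. x \<in> carrier V \<Longrightarrow> c \<odot>\<^bsub>V\<^esub> x \<in> carrier V"
  shows "g \<in> polynomial_functions V"
proof -
  \<comment> \<open>A function that vanishes on the carrier is linear in the sense of \<open>polynomial_functions\<close>.\<close>
  have "(\<lambda>x. g x - f x) \<in> polynomial_functions V"
    using assms(2) closed by (intro polynomial_functions.linear) auto
  from polynomial_functions.add[OF assms(1) this] show ?thesis by simp
qed

lemma polynomial_functions_sum: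
  "(\<And>s. s \<in> S \<Longrightarrow> f s \<in> polynomial_functions V) \<Longrightarrow>
    (\<lambda>x. \<Sum>s\<in>S. f s x) \<in> polynomial_functions V"
  by (induction S rule: infinite_finite_induct)
    (auto intro: polynomial_functions.const polynomial_functions.add)

lemma polynomial_functions_prod:
  "(\<And>s. s \<in> S \<Longrightarrow> f s \<in> polynomial_functions V) \<Longrightarrow>
    (\<lambda>x. \<Prod>s\<in>S. f s x) \<in> polynomial_functions V"
  by (induction S rule: infinite_finite_induct)
    (auto intro: polynomial_functions.const polynomial_functions.mult)

lemma polynomial_functions_diff:
  assumes "f \<in> polynomial_functions V" "g \<in> polynomial_functions V"
  shows "(\<lambda>x. f x - g x) \<in> polynomial_functions V"
  using polynomial_functions.add[OF assms(1)
      polynomial_functions.mult[OF polynomial_functions.const[of "-1"] assms(2)]]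
  by simp

section \<open>Calculus of Zariski-open conditions\<close>

lemma zariski_open_Collect:
  "zariski_open V {x \<in> carrier V. P x} \<longleftrightarrow>
    (\<exists>F \<subseteq> polynomial_functions V. \<forall>x \<in> carrier V. P x \<longleftrightarrow> (\<exists>f \<in> F. f x \<noteq> 0))"
proof -
  have *: "{x \<in> carrier V. P x} = {x \<in> carrier V. \<exists>f \<in> F. f x \<noteq> 0} \<longleftrightarrow>
      (\<forall>x \<in> carrier V. P x \<longleftrightarrow> (\<exists>f \<in> F. f x \<noteq> 0))" for F
    unfolding set_eq_iff Ball_def mem_Collect_eq by (rule iff_allI) argo
  show ?thesis unfolding zariski_open_def * by (rule refl)
qed

lemma zariski_open_nonzero:
  "f \<in> polynomial_functions V \<Longrightarrow> zariski_open V {x \<in> carrier V. f x \<noteq> 0}"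
  unfolding zariski_open_Collect by (intro exI[of _ "{f}"]) auto

text \<open>The defining families are pooled. The index set may be infinite, which is what allows an
  open condition to ask for the existence of auxiliary matrices.\<close>

lemma zariski_open_Bex:
  assumes "\<And>i. i \<in> I \<Longrightarrow> zariski_open V {x \<in> carrier V. P i x}"
  shows "zariski_open V {x \<in> carrier V. \<exists>i \<in> I. P i x}"
proof -
  have "\<forall>i\<in>I. \<exists>F. F \<subseteq> polynomial_functions V \<and>
      (\<forall>x \<in> carrier V. P i x \<longleftrightarrow> (\<exists>f \<in> F. f x \<noteq> 0))"
    using assms unfolding zariski_open_Collect by simp
  from bchoice[OF this] obtain F where
    F: "\<forall>i\<in>I. F i \<subseteq> polynomial_functions V \<and>
      (\<forall>x \<in> carrier V. P i x \<longleftrightarrow> (\<exists>f \<in> F i. f x \<noteq> 0))" ..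
  show ?thesis
    unfolding zariski_open_Collect
    by (rule exI[of _ "\<Union>i\<in>I. F i"]) (use F in \<open>simp add: UN_subset_iff\<close>)
qed

text \<open>Pairwise products of the two families work because the complex numbers have no zero
  divisors.\<close>

lemma zariski_open_conj:
  assumes "zariski_open V {x \<in> carrier V. P x}" "zariski_open V {x \<in> carrier V. Q x}"
  shows "zariski_open V {x \<in> carrier V. P x \<and> Q x}"
proof -
  obtain F G where F: "F \<subseteq> polynomial_functions V"
      "\<forall>x \<in> carrier V. P x \<longleftrightarrow> (\<exists>f \<in> F. f x \<noteq> 0)"
    and G: "G \<subseteq> polynomial_functions V"
      "\<forall>x \<in> carrier V. Q x \<longleftrightarrow> (\<exists>f \<in> G. f x \<noteq> 0)"
    using assms unfolding zariski_open_Collect by (elim exE conjE)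
  have "(\<lambda>(f, g) x. f x * g x) ` (F \<times> G) \<subseteq> polynomial_functions V"
    using F(1) G(1) by (auto intro: polynomial_functions.mult)
  moreover have "\<forall>x \<in> carrier V. P x \<and> Q x \<longleftrightarrow>
      (\<exists>h\<in>(\<lambda>(f, g) x. f x * g x) ` (F \<times> G). h x \<noteq> 0)"
    using F(2) G(2) by auto
  ultimately show ?thesis
    unfolding zariski_open_Collect by blast
qed

section \<open>Matrices whose entries are polynomial functions\<close>

definition polynomial_matrix ::
  "(complex, 'v) module \<Rightarrow> nat \<Rightarrow> nat \<Rightarrow> ('v \<Rightarrow> complex mat) \<Rightarrow> bool" where
  "polynomial_matrix V p q F \<longleftrightarrow>
     (\<forall>x y. x \<in> carrier V \<longrightarrow> y \<in> carrier V \<longrightarrow> x \<oplus>\<^bsub>V\<^esub> y \<in> carrier V) \<and>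
     (\<forall>c x. x \<in> carrier V \<longrightarrow> c \<odot>\<^bsub>V\<^esub> x \<in> carrier V) \<and>
     (\<forall>x \<in> carrier V. F x \<in> carrier_mat p q) \<and>
     (\<forall>i<p. \<forall>j<q. (\<lambda>x. F x $$ (i, j)) \<in> polynomial_functions V)"

lemma polynomial_matrix_carrier:
  "polynomial_matrix V p q F \<Longrightarrow> x \<in> carrier V \<Longrightarrow> F x \<in> carrier_mat p q"
  by (simp add: polynomial_matrix_def)

lemma polynomial_matrix_entry:
  "polynomial_matrix V p q F \<Longrightarrow> i < p \<Longrightarrow> j < q \<Longrightarrow>
    (\<lambda>x. F x $$ (i, j)) \<in> polynomial_functions V"
  by (simp add: polynomial_matrix_def)

text \<open>\<open>V\<close> is an arbitrary record, and replacing a polynomial function by one that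
  agrees with it on the carrier requires closure of the carrier under the operations.
  \<open>polynomial_matrix\<close> includes this closure, and the family \<open>F\<close>, of any
  shape, hands it on to \<open>G\<close>.\<close>

lemma polynomial_matrixI:
  assumes "polynomial_matrix V p' q' F" "\<And>x. x \<in> carrier V \<Longrightarrow> G x \<in> carrier_mat p q"
    and "\<And>i j. i < p \<Longrightarrow> j < q \<Longrightarrow> g i j \<in> polynomial_functions V"
    and "\<And>i j x. i < p \<Longrightarrow> j < q \<Longrightarrow> x \<in> carrier V \<Longrightarrow> G x $$ (i, j) = g i j x"
  shows "polynomial_matrix V p q G"
proof -
  have closed: "\<And>x y. x \<in> carrier V \<Longrightarrow> y \<in> carrier V \<Longrightarrow> x \<oplus>\<^bsub>V\<^esub> y \<in> carrier V"
    "\<And>c x. x \<in> carrier V \<Longrightarrow> c \<odot>\<^bsub>V\<^esub> x \<in> carrier V"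
    using assms(1) by (auto simp: polynomial_matrix_def)
  have "(\<lambda>x. G x $$ (i, j)) \<in> polynomial_functions V" if "i < p" "j < q" for i j
    by (rule polynomial_functions_cong[OF assms(3)[OF that] assms(4)[OF that] closed])
  then show ?thesis
    using closed assms(2) by (simp add: polynomial_matrix_def)
qed

lemma polynomial_function_cong:
  assumes "polynomial_matrix V p q F"
    and "f \<in> polynomial_functions V" "\<And>x. x \<in> carrier V \<Longrightarrow> g x = f x"
  shows "g \<in> polynomial_functions V"
  using assms polynomial_functions_cong[of f V g] unfolding polynomial_matrix_def by blast

lemma polynomial_matrix_const:
  assumes "polynomial_matrix V p' q' F" "C \<in> carrier_mat p q"
  shows "polynomial_matrix V p q (\<lambda>_. C)"
  using assms by (auto simp: polynomial_matrix_def intro: polynomial_functions.const)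

lemma polynomial_matrix_add:
  assumes F: "polynomial_matrix V p q F" and G: "polynomial_matrix V p q G"
  shows "polynomial_matrix V p q (\<lambda>x. F x + G x)"
  by (rule polynomial_matrixI[OF F, where g = "\<lambda>i j x. F x $$ (i, j) + G x $$ (i, j)"])
    (use F G in \<open>auto dest: polynomial_matrix_carrier
      intro!: polynomial_functions.add polynomial_matrix_entry[OF F] polynomial_matrix_entry[OF G]\<close>)

lemma polynomial_matrix_mult:
  assumes F: "polynomial_matrix V p q F" and G: "polynomial_matrix V q r G"
  shows "polynomial_matrix V p r (\<lambda>x. F x * G x)"
  by (rule polynomial_matrixI[OF F,
        where g = "\<lambda>i j x. \<Sum>k<q. F x $$ (i, k) * G x $$ (k, j)"])
    (use polynomial_matrix_carrier[OF F] polynomial_matrix_carrier[OF G] in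
      \<open>auto intro!: polynomial_functions_sum polynomial_functions.mult mat_mult_index_sum
        polynomial_matrix_entry[OF F] polynomial_matrix_entry[OF G] mult_carrier_mat simp del: index_mult_mat\<close>)

lemma polynomial_matrix_smult:
  assumes F: "polynomial_matrix V p q F" and f: "f \<in> polynomial_functions V"
  shows "polynomial_matrix V p q (\<lambda>x. f x \<cdot>\<^sub>m F x)"
  by (rule polynomial_matrixI[OF F, where g = "\<lambda>i j x. f x * F x $$ (i, j)"])
    (use carrier_matD[OF polynomial_matrix_carrier[OF F]] f in
      \<open>auto intro!: carrier_matI polynomial_functions.mult polynomial_matrix_entry[OF F]\<close>)

lemma polynomial_matrix_minus:
  assumes F: "polynomial_matrix V p q F" and G: "polynomial_matrix V p q G"
  shows "polynomial_matrix V p q (\<lambda>x. F x - G x)"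
  by (rule polynomial_matrixI[OF F, where g = "\<lambda>i j x. F x $$ (i, j) - G x $$ (i, j)"])
    (use carrier_matD[OF polynomial_matrix_carrier[OF F]]
       carrier_matD[OF polynomial_matrix_carrier[OF G]] in
      \<open>auto intro!: carrier_matI polynomial_functions_diff
        polynomial_matrix_entry[OF F] polynomial_matrix_entry[OF G]\<close>)

lemma polynomial_matrix_uminus:
  assumes F: "polynomial_matrix V p q F"
  shows "polynomial_matrix V p q (\<lambda>x. - F x)"
proof -
  have "(\<lambda>x. - (F x $$ (i, j))) \<in> polynomial_functions V" if "i < p" "j < q" for i j
    using polynomial_functions_diff[OF polynomial_functions.const[of 0] polynomial_matrix_entry[OF F that]]
    by simp
  then show ?thesis
    by (intro polynomial_matrixI[OF F, where g = "\<lambda>i j x. - (F x $$ (i, j))"])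
      (use carrier_matD[OF polynomial_matrix_carrier[OF F]] in \<open>auto intro!: carrier_matI\<close>)
qed

lemma polynomial_matrix_pow:
  assumes F: "polynomial_matrix V p p F"
  shows "polynomial_matrix V p p (\<lambda>x. F x ^\<^sub>m k)"
proof (induction k)
  case 0
  show ?case
    by (rule polynomial_matrixI[OF F, where g = "\<lambda>i j x. 1\<^sub>m p $$ (i, j)"])
      (use carrier_matD[OF polynomial_matrix_carrier[OF F]] in \<open>auto intro!: carrier_matI polynomial_functions.const\<close>)
next
  case (Suc k)
  show ?case using polynomial_matrix_mult[OF Suc F] by simp
qed

lemma polynomial_function_det:
  assumes F: "polynomial_matrix V p p F"
  shows "(\<lambda>x. det (F x)) \<in> polynomial_functions V"
proof (rule polynomial_function_cong[OF F])
  show "(\<lambda>x. \<Sum>\<pi> | \<pi> permutes {0..<p}. signof \<pi> * (\<Prod>i = 0..<p. F x $$ (i, \<pi> i)))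
      \<in> polynomial_functions V"
    by (intro polynomial_functions_sum polynomial_functions.mult polynomial_functions.const
        polynomial_functions_prod polynomial_matrix_entry[OF F]) auto
qed (use carrier_matD[OF polynomial_matrix_carrier[OF F]] in \<open>auto intro!: det_def' carrier_matI\<close>)

lemma polynomial_matrix_adj:
  assumes F: "polynomial_matrix V p p F"
  shows "polynomial_matrix V p p (\<lambda>x. adj_mat (F x))"
proof (rule polynomial_matrixI[OF F, where g = "\<lambda>i j x. cofactor (F x) j i"])
  fix i j assume ij: "i < p" "j < p"
  have "polynomial_matrix V (p - 1) (p - 1) (\<lambda>x. mat_delete (F x) j i)"
  proof (rule polynomial_matrixI[OF F, where g = "\<lambda>i' j' x.
        F x $$ (if i' < j then i' else Suc i', if j' < i then j' else Suc j')"])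
    fix i' j' x assume "i' < p - 1" "j' < p - 1" "x \<in> carrier V"
    then show "mat_delete (F x) j i $$ (i', j') =
        F x $$ (if i' < j then i' else Suc i', if j' < i then j' else Suc j')"
      using carrier_matD[OF polynomial_matrix_carrier[OF F]] ij
      by (auto simp: mat_delete_def)
  qed (use carrier_matD[OF polynomial_matrix_carrier[OF F]] in
      \<open>auto intro!: polynomial_matrix_entry[OF F] carrier_matI simp: mat_delete_def\<close>)
  then show "(\<lambda>x. cofactor (F x) j i) \<in> polynomial_functions V"
    unfolding cofactor_def
    by (intro polynomial_functions.mult polynomial_functions.const polynomial_function_det)
qed (use carrier_matD[OF polynomial_matrix_carrier[OF F]] in \<open>auto simp: adj_mat_def intro!: carrier_matI\<close>)

lemma polynomial_matrix_transpose:
  assumes F: "polynomial_matrix V p q F"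
  shows "polynomial_matrix V q p (\<lambda>x. transpose_mat (F x))"
  by (rule polynomial_matrixI[OF F, where g = "\<lambda>i j x. F x $$ (j, i)"])
    (use carrier_matD[OF polynomial_matrix_carrier[OF F]] in \<open>auto intro!: carrier_matI polynomial_matrix_entry[OF F]\<close>)

lemma polynomial_matrix_fst: "polynomial_matrix (direct_sum (Mat n m) (Mat n m)) n m fst"
  and polynomial_matrix_snd: "polynomial_matrix (direct_sum (Mat n m) (Mat n m)) n m snd"
  unfolding polynomial_matrix_def
  by (auto simp: direct_sum_def module_mat_simps intro!: polynomial_functions.linear)

section \<open>Kronecker blocks\<close>

lemma diag_block_mat_mult:
  assumes "\<And>x. x \<in> set xs \<Longrightarrow> dim_col (f x) = dim_row (g x)"
  shows "diag_block_mat (map f xs) * diag_block_mat (map g xs) =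
    diag_block_mat (map (\<lambda>x. f x * g x) xs)"
  using assms
proof (induction xs)
  case (Cons x xs)
  let ?F = "diag_block_mat (map f xs)" and ?G = "diag_block_mat (map g xs)"
  have d: "dim_col ?F = dim_row ?G"
    using Cons.prems by (auto simp: dim_diag_block_mat comp_def intro!: arg_cong[of _ _ sum_list])
  have IH: "?F * ?G = diag_block_mat (map (\<lambda>x. f x * g x) xs)"
    using Cons by simp
  have "four_block_mat (f x) (0\<^sub>m (dim_row (f x)) (dim_col ?F)) (0\<^sub>m (dim_row ?F) (dim_col (f x))) ?F *
      four_block_mat (g x) (0\<^sub>m (dim_row (g x)) (dim_col ?G)) (0\<^sub>m (dim_row ?G) (dim_col (g x))) ?G =
    four_block_mat (f x * g x) (0\<^sub>m (dim_row (f x)) (dim_col ?G))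
      (0\<^sub>m (dim_row ?F) (dim_col (g x))) (?F * ?G)"
    using Cons.prems[of x] d
    by (subst mult_four_block_mat[of _ "dim_row (f x)" "dim_col (f x)" _ "dim_col ?F" _ "dim_row ?F"
          _ _ "dim_col (g x)" _ "dim_col ?G"]) auto
  then show ?case by (simp add: Let_def IH[symmetric])
qed simp

lemma diag_block_mat_add:
  fixes f g :: "'b \<Rightarrow> 'a :: monoid_add mat"
  assumes "\<And>x. x \<in> set xs \<Longrightarrow> dim_row (f x) = dim_row (g x) \<and> dim_col (f x) = dim_col (g x)"
  shows "diag_block_mat (map f xs) + diag_block_mat (map g xs) =
    diag_block_mat (map (\<lambda>x. f x + g x) xs)"
  using assms
proof (induction xs)
  case (Cons x xs)
  let ?F = "diag_block_mat (map f xs)" and ?G = "diag_block_mat (map g xs)"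
  have d: "dim_row ?F = dim_row ?G" "dim_col ?F = dim_col ?G"
    using Cons.prems by (auto simp: dim_diag_block_mat comp_def intro!: arg_cong[of _ _ sum_list])
  have IH: "diag_block_mat (map (\<lambda>x. f x + g x) xs) = ?F + ?G"
    using Cons by simp
  show ?case
    unfolding list.simps diag_block_mat.simps Let_def IH
    by (rule eq_matI) (use Cons.prems[of x] d in auto)
qed simp

lemma diag_block_mat_transpose:
  "transpose_mat (diag_block_mat (map f xs)) = diag_block_mat (map (\<lambda>x. transpose_mat (f x)) xs)"
proof (induction xs)
  case (Cons x xs)
  have "dim_row (diag_block_mat (map (\<lambda>x. transpose_mat (f x)) xs)) = dim_col (diag_block_mat (map f xs))"
    "dim_col (diag_block_mat (map (\<lambda>x. transpose_mat (f x)) xs)) = dim_row (diag_block_mat (map f xs))"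
    by (simp_all flip: Cons)
  with Cons show ?case
    by (simp add: Let_def transpose_four_block_mat[of _ "dim_row (f x)" "dim_col (f x)" _
          "dim_col (diag_block_mat (map f xs))" _ "dim_row (diag_block_mat (map f xs))"])
qed simp

lemma diag_block_mat_one: "diag_block_mat (map (\<lambda>x. 1\<^sub>m (d x)) xs) = 1\<^sub>m (\<Sum>x\<leftarrow>xs. d x)"
  by (induction xs) (auto simp: Let_def intro: eq_matI)

lemma diag_block_mat_zero:
  "diag_block_mat (map (\<lambda>x. 0\<^sub>m (d x) (e x)) xs) = 0\<^sub>m (\<Sum>x\<leftarrow>xs. d x) (\<Sum>x\<leftarrow>xs. e x)"
  by (induction xs) (simp_all add: Let_def)

section \<open>Pencils that consist of horizontal Kronecker blocks only\<close>

definition kron_fst :: "nat list \<Rightarrow> complex mat" where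
  "kron_fst hs = diag_block_mat (map (\<lambda>h. block_fst (Horizontal h)) hs)"

definition kron_snd :: "nat list \<Rightarrow> complex mat" where
  "kron_snd hs = diag_block_mat (map (\<lambda>h. block_snd (Horizontal h)) hs)"

definition height :: "nat list \<Rightarrow> nat" where
  "height hs = (\<Sum>h\<leftarrow>hs. h - 1)"

lemma kron_carrier [simp]:
  "kron_fst hs \<in> carrier_mat (height hs) (sum_list hs)"
  "kron_snd hs \<in> carrier_mat (height hs) (sum_list hs)"
  by (auto simp: height_def kron_fst_def kron_snd_def dim_diag_block_mat comp_def intro!: carrier_matI)

text \<open>Multiplication by \<open>(0 | I)\<close> deletes the first row and by
  \<open>(I | 0)\<close> the last, so identities between blocks become index shifts.\<close>

lemma horizontal_mult:
  assumes "dim_row X = h"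
  shows "block_fst (Horizontal h) * X = mat (h - 1) (dim_col X) (\<lambda>(i, j). X $$ (Suc i, j))"
    and "block_snd (Horizontal h) * X = mat (h - 1) (dim_col X) (\<lambda>(i, j). X $$ (i, j))"
proof -
  have *: "(\<Sum>k = 0..<h. (if k = l then 1 else 0) * X $$ (k, j)) = X $$ (l, j)"
    if "l < h" for l j
  proof -
    have "(\<Sum>k = 0..<h. (if k = l then 1 else 0) * X $$ (k, j)) =
        (\<Sum>k = 0..<h. if k = l then X $$ (k, j) else 0)"
      by (rule sum.cong) auto
    then show ?thesis using that by simp
  qed
  show "block_fst (Horizontal h) * X = mat (h - 1) (dim_col X) (\<lambda>(i, j). X $$ (Suc i, j))"
    by (rule eq_matI) (use assms * in \<open>auto simp: scalar_prod_def\<close>)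
  show "block_snd (Horizontal h) * X = mat (h - 1) (dim_col X) (\<lambda>(i, j). X $$ (i, j))"
    by (rule eq_matI) (use assms * in \<open>auto simp: scalar_prod_def\<close>)
qed

lemma dim_block_Horizontal:
  "dim_row (block_fst (Horizontal h)) = h - 1" "dim_col (block_fst (Horizontal h)) = h"
  "dim_row (block_snd (Horizontal h)) = h - 1" "dim_col (block_snd (Horizontal h)) = h"
  by simp_all

lemma kron_right_inverse:
  "kron_fst hs * transpose_mat (kron_fst hs) = 1\<^sub>m (height hs)"
  "kron_snd hs * transpose_mat (kron_snd hs) = 1\<^sub>m (height hs)"
proof -
  have *: "block_fst (Horizontal h) * transpose_mat (block_fst (Horizontal h)) = 1\<^sub>m (h - 1)"
    "block_snd (Horizontal h) * transpose_mat (block_snd (Horizontal h)) = 1\<^sub>m (h - 1)" for h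
    by (simp only: horizontal_mult index_transpose_mat dim_block_Horizontal, rule eq_matI; auto)+
  show "kron_fst hs * transpose_mat (kron_fst hs) = 1\<^sub>m (height hs)"
    and "kron_snd hs * transpose_mat (kron_snd hs) = 1\<^sub>m (height hs)"
    by (simp_all only: height_def kron_fst_def kron_snd_def diag_block_mat_transpose diag_block_mat_mult
        index_transpose_mat * diag_block_mat_one)
qed

text \<open>A block of width 2 has a single row, a different unit vector in each of the two
  matrices, and a block of width 1 has no row. From width 3 on the two matrices share a unit row;
  hence the base case is limited to the widths 1 and 2.\<close>

lemma kron_orthogonal:
  assumes "set hs \<subseteq> {1, 2}"
  shows "kron_fst hs * transpose_mat (kron_snd hs) = 0\<^sub>m (height hs) (height hs)"
    and "kron_snd hs * transpose_mat (kron_fst hs) = 0\<^sub>m (height hs) (height hs)"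
proof -
  have *: "block_fst (Horizontal h) * transpose_mat (block_snd (Horizontal h)) = 0\<^sub>m (h - 1) (h - 1)"
    "block_snd (Horizontal h) * transpose_mat (block_fst (Horizontal h)) = 0\<^sub>m (h - 1) (h - 1)"
    if "h \<in> set hs" for h
  proof -
    have "h = 1 \<or> h = 2" using that assms by auto
    then show "block_fst (Horizontal h) * transpose_mat (block_snd (Horizontal h)) = 0\<^sub>m (h - 1) (h - 1)"
      "block_snd (Horizontal h) * transpose_mat (block_fst (Horizontal h)) = 0\<^sub>m (h - 1) (h - 1)"
      by (simp_all only: horizontal_mult index_transpose_mat dim_block_Horizontal)
        (rule eq_matI; auto)+
  qed
  have "map (\<lambda>h. block_fst (Horizontal h) * transpose_mat (block_snd (Horizontal h))) hs =
      map (\<lambda>h. 0\<^sub>m (h - 1) (h - 1)) hs"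
    "map (\<lambda>h. block_snd (Horizontal h) * transpose_mat (block_fst (Horizontal h))) hs =
      map (\<lambda>h. 0\<^sub>m (h - 1) (h - 1)) hs"
    using * by (intro list.map_cong refl, simp only:)+
  then show "kron_fst hs * transpose_mat (kron_snd hs) = 0\<^sub>m (height hs) (height hs)"
    and "kron_snd hs * transpose_mat (kron_fst hs) = 0\<^sub>m (height hs) (height hs)"
    by (simp_all only: height_def kron_fst_def kron_snd_def diag_block_mat_transpose diag_block_mat_mult
        index_transpose_mat dim_block_Horizontal diag_block_mat_zero)
qed

lemma height_Suc [simp]: "height (map Suc hs) = sum_list hs"
  by (induction hs) (auto simp: height_def)

text \<open>Both products delete the first and the last coordinate. In terms of cokernels, the
  blocks of width h annihilate the stacked blocks of width h + 1.\<close>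

lemma kron_commute:
  "kron_fst hs * kron_snd (map Suc hs) = kron_snd hs * kron_fst (map Suc hs)"
proof -
  have *: "block_fst (Horizontal h) * block_snd (Horizontal (Suc h)) =
      block_snd (Horizontal h) * block_fst (Horizontal (Suc h))" for h
    by (simp only: horizontal_mult dim_block_Horizontal) (rule eq_matI; auto)
  show ?thesis
    by (simp only: kron_fst_def kron_snd_def map_map comp_def diag_block_mat_mult
        dim_block_Horizontal diff_Suc_1 *)
qed

text \<open>In a block of width h + 1, the transpose of \<open>(0 | I)\<close> times
  \<open>(0 | I)\<close> is the identity except for a zero in the top left corner, and
  \<open>e h\<close> restores this corner from \<open>(I | 0)\<close>. For h = 0 the block is a zero
  column, which no matrix on the left can recover.\<close>

lemma kron_left_inverse:
  assumes "0 \<notin> set hs"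
  obtains J1 J2 where "J1 \<in> carrier_mat (sum_list (map Suc hs)) (sum_list hs)"
    "J2 \<in> carrier_mat (sum_list (map Suc hs)) (sum_list hs)"
    "J1 * kron_fst (map Suc hs) + J2 * kron_snd (map Suc hs) = 1\<^sub>m (sum_list (map Suc hs))"
proof
  define e :: "nat \<Rightarrow> complex mat" where "e h = mat (Suc h) h (\<lambda>(i, j). if i = 0 \<and> j = 0 then 1 else 0)" for h
  let ?J1 = "transpose_mat (kron_fst (map Suc hs))" and ?J2 = "diag_block_mat (map e hs)"
  show "?J1 \<in> carrier_mat (sum_list (map Suc hs)) (sum_list hs)"
    using kron_carrier(1)[of "map Suc hs"] by simp
  show "?J2 \<in> carrier_mat (sum_list (map Suc hs)) (sum_list hs)"
    by (auto simp: dim_diag_block_mat comp_def e_def intro!: carrier_matI)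
  show "?J1 * kron_fst (map Suc hs) + ?J2 * kron_snd (map Suc hs) = 1\<^sub>m (sum_list (map Suc hs))"
  proof -
    have *: "transpose_mat (block_fst (Horizontal (Suc h))) * block_fst (Horizontal (Suc h)) +
        e h * block_snd (Horizontal (Suc h)) = 1\<^sub>m (Suc h)" if "h \<noteq> 0" for h
    proof -
      have 1: "(\<Sum>k = 0..<h. (if i = Suc k then 1 else 0) * (if j = Suc k then 1 else 0)) =
          (if i = j \<and> i \<noteq> 0 then 1 else 0 :: complex)" if "i < Suc h" for i j
      proof (cases i)
        case (Suc l)
        have "(\<Sum>k = 0..<h. (if i = Suc k then 1 else 0) * (if j = Suc k then 1 else 0)) =
            (\<Sum>k = 0..<h. if k = l then (if j = i then 1 else 0 :: complex) else 0)"
          by (rule sum.cong) (auto simp: Suc)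
        with that Suc show ?thesis by auto
      qed simp
      have 2: "(\<Sum>k = 0..<h. (if i = 0 \<and> k = 0 then 1 else 0) * (if j = k then 1 else 0)) =
          (if i = j \<and> i = 0 then 1 else 0 :: complex)" for i j
      proof -
        have "(\<Sum>k = 0..<h. (if i = 0 \<and> k = 0 then 1 else 0) * (if j = k then 1 else 0)) =
            (\<Sum>k = 0..<h. if k = 0 then (if i = 0 \<and> j = 0 then 1 else 0 :: complex) else 0)"
          by (rule sum.cong) auto
        with that show ?thesis by auto
      qed
      show ?thesis
        by (rule eq_matI) (simp_all add: scalar_prod_def e_def 1 2 cong: if_cong)
    qed
    have "map (\<lambda>h. transpose_mat (block_fst (Horizontal (Suc h))) * block_fst (Horizontal (Suc h)) +
        e h * block_snd (Horizontal (Suc h))) hs = map (\<lambda>h. 1\<^sub>m (Suc h)) hs"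
      by (rule list.map_cong[OF refl], rule *) (use assms in metis)
    moreover have "dim_row (e h) = Suc h" "dim_col (e h) = h" for h
      by (simp_all add: e_def)
    ultimately show ?thesis
      by (simp only: kron_fst_def kron_snd_def map_map comp_def diag_block_mat_transpose
          diag_block_mat_mult diag_block_mat_add index_transpose_mat dim_block_Horizontal
          diff_Suc_1 index_mult_mat diag_block_mat_one)
  qed
qed

section \<open>Factoring kernel elements through a stacked pencil\<close>

lemma four_block_mat_left_inject:
  assumes "four_block_mat A B C D = four_block_mat A' B' C' D'"
    and "A \<in> carrier_mat n m" "A' \<in> carrier_mat n m" "C \<in> carrier_mat k m" "C' \<in> carrier_mat k m"
    and "D \<in> carrier_mat k l" "D' \<in> carrier_mat k l"
  shows "A = A'" "C = C'"
proof -
  have *: "four_block_mat A B C D $$ ij = four_block_mat A' B' C' D' $$ ij" for ij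
    using assms(1) by simp
  show "A = A'"
  proof (rule eq_matI)
    fix i j assume "i < dim_row A'" "j < dim_col A'"
    with *[of "(i, j)"] assms(2-) show "A $$ (i, j) = A' $$ (i, j)" by simp
  qed (use assms in auto)
  show "C = C'"
  proof (rule eq_matI)
    fix i j assume "i < dim_row C'" "j < dim_col C'"
    with *[of "(n + i, j)"] assms(2-) show "C $$ (i, j) = C' $$ (i, j)" by simp
  qed (use assms in auto)
qed

text \<open>The column \<open>(A; B)\<close> is completed to a two-sided inverse of the square matrix
  \<open>((L2, L1), (N2, N1))\<close>, so it spans the kernel of \<open>(N2, N1)\<close>.\<close>

lemma kernel_factorization:
  fixes A B :: "complex mat"
  assumes A: "A \<in> carrier_mat m n" and B: "B \<in> carrier_mat m n"
    and L1: "L1 \<in> carrier_mat n m" and L2: "L2 \<in> carrier_mat n m"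
    and N1: "N1 \<in> carrier_mat p m" and N2: "N2 \<in> carrier_mat p m"
    and Y: "Y \<in> carrier_mat m p"
    and X1: "X1 \<in> carrier_mat m k" and X2: "X2 \<in> carrier_mat m k"
    and dim: "n + p = m + m"
    and L: "L1 * B + L2 * A = 1\<^sub>m n" and N: "N1 * B + N2 * A = 0\<^sub>m p n"
    and NY: "N1 * Y = 1\<^sub>m p" and NX: "N1 * X2 + N2 * X1 = 0\<^sub>m p k"
  shows "A * (L1 * X2 + L2 * X1) = X1" "B * (L1 * X2 + L2 * X1) = X2"
proof -
  \<comment> \<open>The choice makes the upper right block of the product \<open>?M * ?W\<close>
    vanish: it equals \<open>L1 * Y + Z\<close>.\<close>
  define Z where "Z = - (L1 * Y)"
  have Z: "Z \<in> carrier_mat n p" using L1 Y by (simp add: Z_def)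
  let ?R = "L1 * X2 + L2 * X1"
  let ?M = "four_block_mat L2 L1 N2 N1"
  let ?W = "four_block_mat A (A * Z) B (Y + B * Z)"
  \<comment> \<open>Right-hand blocks of width zero turn the stacked column into a four-block
    matrix.\<close>
  let ?X = "four_block_mat X1 (0\<^sub>m m 0) X2 (0\<^sub>m m 0)"
  have "L2 * (A * Z) + L1 * (Y + B * Z) = L1 * Y + (L1 * B + L2 * A) * Z"
    using A B L1 L2 Y Z
    by (simp add: mult_add_distrib_mat[of _ n m] add_mult_distrib_mat[of _ n n _ _ p]
        assoc_mult_mat[of _ n m _ n _ p])
      (rule eq_matI; simp)
  also have "\<dots> = 0\<^sub>m n p" unfolding L by (rule eq_matI) (use Z L1 Y in \<open>auto simp: Z_def\<close>)
  finally have 1: "L2 * (A * Z) + L1 * (Y + B * Z) = 0\<^sub>m n p" .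
  have "N2 * (A * Z) + N1 * (Y + B * Z) = N1 * Y + (N1 * B + N2 * A) * Z"
    using A B N1 N2 Y Z
    by (simp add: mult_add_distrib_mat[of _ p m] add_mult_distrib_mat[of _ p n _ _ p]
        assoc_mult_mat[of _ p m _ n _ p])
      (rule eq_matI; simp)
  also have "\<dots> = 1\<^sub>m p" using Z unfolding N NY by simp
  finally have 2: "N2 * (A * Z) + N1 * (Y + B * Z) = 1\<^sub>m p" .
  have 3: "L2 * A + L1 * B = 1\<^sub>m n" "N2 * A + N1 * B = 0\<^sub>m p n"
    using L N comm_add_mat[OF mult_carrier_mat[OF L2 A] mult_carrier_mat[OF L1 B]]
      comm_add_mat[OF mult_carrier_mat[OF N2 A] mult_carrier_mat[OF N1 B]] by simp_all
  have AZ: "A * Z \<in> carrier_mat m p" "Y + B * Z \<in> carrier_mat m p"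
    using A B Y Z by auto
  have M: "?M \<in> carrier_mat (m + m) (m + m)"
    using four_block_carrier_mat[OF L2 N1] by (simp add: dim)
  have W: "?W \<in> carrier_mat (m + m) (m + m)"
    using four_block_carrier_mat[OF A AZ(2)] by (simp add: dim)
  have "?M * ?W = 1\<^sub>m (n + p)"
    unfolding mult_four_block_mat[OF L2 L1 N2 N1 A AZ(1) B AZ(2)] 1 2 3
    by (rule four_block_one_mat)
  \<comment> \<open>The matrices are square because n + p = 2m, so the one-sided inverse is
    two-sided and \<open>?X\<close> can be written as \<open>?W * (?M * ?X)\<close>.\<close>
  then have WM: "?W * ?M = 1\<^sub>m (m + m)"
    using mat_mult_left_right_inverse[OF M W] by (simp add: dim)
  have MX: "?M * ?X = four_block_mat ?R (0\<^sub>m n 0) (0\<^sub>m p k) (0\<^sub>m p 0)"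
  proof -
    have "L2 * X1 + L1 * X2 = ?R" "N2 * X1 + N1 * X2 = 0\<^sub>m p k"
      using NX comm_add_mat[OF mult_carrier_mat[OF L2 X1] mult_carrier_mat[OF L1 X2]]
        comm_add_mat[OF mult_carrier_mat[OF N2 X1] mult_carrier_mat[OF N1 X2]] by simp_all
    then show ?thesis
      using L1 L2 N1 N2
      unfolding mult_four_block_mat[OF L2 L1 N2 N1 X1 zero_carrier_mat X2 zero_carrier_mat]
      by (intro cong_four_block_mat) (auto intro!: eq_matI)
  qed
  have X: "?X \<in> carrier_mat (m + m) (k + 0)"
    by (rule four_block_carrier_mat[OF X1 zero_carrier_mat])
  have R: "?R \<in> carrier_mat n k" using L1 L2 X1 X2 by auto
  have "?X = ?W * (?M * ?X)"
    using assoc_mult_mat[OF W M X] unfolding WM left_mult_one_mat[OF X] .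
  also have "\<dots> = four_block_mat (A * ?R) (0\<^sub>m m 0) (B * ?R) (0\<^sub>m m 0)"
    unfolding MX mult_four_block_mat[OF A AZ(1) B AZ(2) R zero_carrier_mat zero_carrier_mat zero_carrier_mat]
    using A B Z R AZ by (intro cong_four_block_mat) (auto intro!: eq_matI)
  finally have *: "?X = four_block_mat (A * ?R) (0\<^sub>m m 0) (B * ?R) (0\<^sub>m m 0)" .
  show "A * ?R = X1" "B * ?R = X2"
    using four_block_mat_left_inject[OF *, of m k m 0] A B L1 L2 X1 X2 by auto
qed

section \<open>Generic pencils and the base of the induction\<close>

text \<open>\<open>G\<close> plays the role of a non-empty Zariski open set of pencils; openness is tested on all
  families of pencils that depend polynomially on a point of \<open>V\<close>.\<close>

definition generic_pencil ::
  "(complex, 'v) module \<Rightarrow> nat \<Rightarrow> nat \<Rightarrow> pencil_block list set \<Rightarrow> bool" where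
  "generic_pencil V m n S \<longleftrightarrow>
     (\<exists>G. (\<forall>F1 F2. polynomial_matrix V m n F1 \<longrightarrow> polynomial_matrix V m n F2 \<longrightarrow>
              zariski_open V {x \<in> carrier V. G (F1 x) (F2 x)}) \<and>
          (\<exists>A \<in> carrier_mat m n. \<exists>B \<in> carrier_mat m n. G A B) \<and>
          (\<forall>A \<in> carrier_mat m n. \<forall>B \<in> carrier_mat m n. G A B \<longrightarrow>
              (\<exists>bs \<in> S. pencil_equiv m n A B bs)))"

lemma map_block_Horizontal:
  "diag_block_mat (map block_fst (map Horizontal hs)) = kron_fst hs"
  "diag_block_mat (map block_snd (map Horizontal hs)) = kron_snd hs"
  by (simp_all add: kron_fst_def kron_snd_def comp_def)

lemma mutually_inverse_one: "mutually_inverse n (1\<^sub>m n) (1\<^sub>m n)"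
  by (simp add: mutually_inverse_def)

lemma mutually_inverse_det:
  assumes "A \<in> carrier_mat n n" "det A \<noteq> 0"
  obtains A' where "mutually_inverse n A A'"
proof
  show "mutually_inverse n A ((1 / det A) \<cdot>\<^sub>m adj_mat A)"
    using adj_mat[OF assms(1)] assms
    by (intro mutually_inverseI) (auto simp: mult_smult_distrib[of _ n n _ n])
qed

text \<open>With widths at most 2, the rows of A and B together fit into a square matrix:
  \<open>M A B\<close> places them at the coordinates of the blocks of width 2 and fills the
  coordinates of the blocks of width 1 with unit rows. When it is invertible, its inverse is the
  required change of basis of the source, and the target keeps its basis.\<close>

lemma generic_pencil_base:
  fixes V :: "(complex, 'v) module"
  assumes hs: "set hs \<subseteq> {1, 2}"
  shows "generic_pencil V (height hs) (sum_list hs) {map Horizontal hs}"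
proof -
  let ?p = "height hs" and ?n = "sum_list hs"
  let ?K1 = "kron_fst hs" and ?K2 = "kron_snd hs"
  let ?T1 = "transpose_mat ?K1" and ?T2 = "transpose_mat ?K2"
  let ?S = "?T1 * ?K1 + ?T2 * ?K2"
  define M where "M A B = (1\<^sub>m ?n - ?S) + (?T1 * A + ?T2 * B)" for A B
  have T: "?T1 \<in> carrier_mat ?n ?p" "?T2 \<in> carrier_mat ?n ?p"
    using kron_carrier by simp_all
  have S: "?S \<in> carrier_mat ?n ?n"
    by (rule add_carrier_mat, rule mult_carrier_mat[OF T(2) kron_carrier(2)])
  then have S: "?S \<in> carrier_mat ?n ?n" "1\<^sub>m ?n - ?S \<in> carrier_mat ?n ?n"
    by (simp_all add: minus_carrier_mat)
  have M: "M A B \<in> carrier_mat ?n ?n" if "A \<in> carrier_mat ?p ?n" "B \<in> carrier_mat ?p ?n" for A B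
    unfolding M_def by (intro add_carrier_mat mult_carrier_mat[OF T(2)] that)
  have KT: "?K1 * (?T1 * A + ?T2 * B) = A" "?K2 * (?T1 * A + ?T2 * B) = B"
    if AB: "A \<in> carrier_mat ?p ?n" "B \<in> carrier_mat ?p ?n" for A B
  proof -
    have "X * (?T1 * A + ?T2 * B) = X * ?T1 * A + X * ?T2 * B" if X: "X \<in> carrier_mat ?p ?n" for X
      using mult_add_distrib_mat[OF X mult_carrier_mat[OF T(1) AB(1)] mult_carrier_mat[OF T(2) AB(2)]]
        assoc_mult_mat[OF X T(1) AB(1)] assoc_mult_mat[OF X T(2) AB(2)] by simp
    then show "?K1 * (?T1 * A + ?T2 * B) = A" "?K2 * (?T1 * A + ?T2 * B) = B"
      using AB by (simp_all add: kron_right_inverse kron_orthogonal[OF hs])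
  qed
  have KM: "?K1 * M A B = A" "?K2 * M A B = B"
    if AB: "A \<in> carrier_mat ?p ?n" "B \<in> carrier_mat ?p ?n" for A B
  proof -
    have c: "?T1 * A + ?T2 * B \<in> carrier_mat ?n ?n"
      by (intro add_carrier_mat mult_carrier_mat[OF T(2)] AB)
    have "K * (1\<^sub>m ?n - ?S) = K - K * ?S" if "K \<in> carrier_mat ?p ?n" for K
      using that S by (simp add: mult_minus_distrib_mat[of _ ?p ?n _ ?n])
    \<comment> \<open>\<open>KT\<close> at the canonical pencil says that \<open>?K1\<close> and
      \<open>?K2\<close> absorb \<open>?S\<close>, so they do not see the added unit rows.\<close>
    then have "?K1 * (1\<^sub>m ?n - ?S) = 0\<^sub>m ?p ?n" "?K2 * (1\<^sub>m ?n - ?S) = 0\<^sub>m ?p ?n"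
      using KT[OF kron_carrier] by (simp_all add: minus_r_inv_mat[of _ ?p ?n])
    then show "?K1 * M A B = A" "?K2 * M A B = B"
      unfolding M_def using S c KT[OF AB] AB
      by (simp_all add: mult_add_distrib_mat[of _ ?p ?n _ ?n])
  qed
  show ?thesis
    unfolding generic_pencil_def
  proof (intro exI[of _ "\<lambda>A B. det (M A B) \<noteq> 0"] conjI allI impI ballI)
    fix F1 F2 assume F: "polynomial_matrix V ?p ?n F1" "polynomial_matrix V ?p ?n F2"
    show "zariski_open V {x \<in> carrier V. det (M (F1 x) (F2 x)) \<noteq> 0}"
      unfolding M_def
      by (intro zariski_open_nonzero polynomial_function_det[of _ ?n] polynomial_matrix_add
          polynomial_matrix_mult[of _ _ ?p] polynomial_matrix_const[OF F(1)] F S T)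
  next
    \<comment> \<open>At the canonical pencil the two parts of \<open>M\<close> are complementary
      projections.\<close>
    have "M ?K1 ?K2 = 1\<^sub>m ?n"
      unfolding M_def by (rule eq_matI) (use S carrier_matD[OF S(1)] in auto)
    then show "\<exists>A\<in>carrier_mat ?p ?n. \<exists>B\<in>carrier_mat ?p ?n. det (M A B) \<noteq> 0"
      by (intro bexI[of _ ?K1] bexI[of _ ?K2]) auto
  next
    fix A B assume AB: "A \<in> carrier_mat ?p ?n" "B \<in> carrier_mat ?p ?n" and "det (M A B) \<noteq> 0"
    then obtain Q where Q: "mutually_inverse ?n (M A B) Q"
      using mutually_inverse_det M by blast
    have c: "Q \<in> carrier_mat ?n ?n" "M A B * Q = 1\<^sub>m ?n"
      using Q by (auto simp: mutually_inverse_def)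
    have "A * Q = ?K1 * M A B * Q" "B * Q = ?K2 * M A B * Q"
      using KM[OF AB] by simp_all
    then have "A * Q = ?K1" "B * Q = ?K2"
      using c M[OF AB] right_mult_one_mat[OF kron_carrier(1)] right_mult_one_mat[OF kron_carrier(2)]
      by (simp_all add: assoc_mult_mat[of _ ?p ?n _ ?n _ ?n])
    then have "A * Q = 1\<^sub>m ?p * ?K1" "B * Q = 1\<^sub>m ?p * ?K2"
      by (simp_all add: left_mult_one_mat[OF kron_carrier(1)] left_mult_one_mat[OF kron_carrier(2)])
    then have "pencil_equiv ?p ?n A B (map Horizontal hs)"
      unfolding pencil_equiv_def map_block_Horizontal
      using mutually_inverse_one mutually_inverse_sym[OF Q] kron_carrier[of hs] by blast
    then show "\<exists>bs\<in>{map Horizontal hs}. pencil_equiv ?p ?n A B bs" by simp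
  qed
qed

section \<open>Raising the generic horizontal indices by one\<close>

lemma mat_mult_assoc_dim:
  fixes A B C :: "'a :: semiring_0 mat"
  assumes "dim_col A = dim_row B" "dim_col B = dim_row C"
  shows "A * B * C = A * (B * C)"
  using assms by (intro assoc_mult_mat[of _ "dim_row A" "dim_col A" _ "dim_col B" _ "dim_col C"]) auto

lemma mat_distrib_left_dim:
  fixes A B C :: "'a :: semiring_0 mat"
  assumes "dim_col A = dim_row B" "dim_row B = dim_row C" "dim_col B = dim_col C"
  shows "A * (B + C) = A * B + A * C"
  using assms by (intro mult_add_distrib_mat[of _ "dim_row A" "dim_col A" _ "dim_col B"]) auto

lemma mat_diff_distrib_right_dim:
  fixes A B C :: "'a :: ring mat"
  assumes "dim_col A = dim_row C" "dim_row A = dim_row B" "dim_col A = dim_col B"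
  shows "(A - B) * C = A * C - B * C"
  using assms by (intro minus_mult_distrib_mat[of _ "dim_row A" "dim_col A" _ _ "dim_col C"]) auto

lemma mat_smult_mult_dim:
  fixes A B :: "'a :: comm_semiring_0 mat"
  assumes "dim_col A = dim_row B"
  shows "(c \<cdot>\<^sub>m A) * B = c \<cdot>\<^sub>m (A * B)" "A * (c \<cdot>\<^sub>m B) = c \<cdot>\<^sub>m (A * B)"
proof -
  have "A \<in> carrier_mat (dim_row A) (dim_row B)" "B \<in> carrier_mat (dim_row B) (dim_col B)"
    using assms by auto
  then show "(c \<cdot>\<^sub>m A) * B = c \<cdot>\<^sub>m (A * B)" "A * (c \<cdot>\<^sub>m B) = c \<cdot>\<^sub>m (A * B)"
    by (rule mult_smult_assoc_mat, rule mult_smult_distrib)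
qed

lemma mat_smult_add_dim:
  fixes A B :: "'a :: semiring_0 mat"
  assumes "dim_row A = dim_row B" "dim_col A = dim_col B"
  shows "c \<cdot>\<^sub>m A + c \<cdot>\<^sub>m B = c \<cdot>\<^sub>m (A + B)"
  using assms by (intro eq_matI) (simp_all add: distrib_left)

text \<open>A change of basis \<open>Q\<close> in the source of the cokernel pencil is one in the
  target of \<open>(A, B)\<close>. The raised blocks satisfy the commutation relation of
  \<open>kron_commute\<close>, so \<open>(Q * K1'; Q * K2')\<close> is annihilated by the cokernel
  pencil and therefore equals \<open>(A; B) * R\<close>. This \<open>R\<close> is the change of
  basis in the source.\<close>

lemma generic_pencil_step:
  fixes V :: "(complex, 'v) module"
  assumes pos: "0 \<notin> set hs" and gen: "generic_pencil V (height hs) (sum_list hs) {map Horizontal hs}"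
  shows "generic_pencil V (sum_list hs) (sum_list (map Suc hs)) {map Horizontal (map Suc hs)}"
proof -
  define p m n where pmn: "p = height hs" "m = sum_list hs" "n = sum_list (map Suc hs)"
  \<comment> \<open>Each block contributes (h + 1) + (h - 1) = 2h; positivity matters because the
    subtraction is truncated at 0.\<close>
  have dim: "n + p = m + m"
    using pos unfolding pmn height_def by (induction hs) auto
  define K1 K2 K1' K2' where K: "K1 = kron_fst hs" "K2 = kron_snd hs"
    "K1' = kron_fst (map Suc hs)" "K2' = kron_snd (map Suc hs)"
  have Kc [simp]: "K1 \<in> carrier_mat p m" "K2 \<in> carrier_mat p m"
    "K1' \<in> carrier_mat m n" "K2' \<in> carrier_mat m n"
    using kron_carrier[of hs] kron_carrier[of "map Suc hs"] by (simp_all add: K pmn)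
  note [simp] = Kc[THEN carrier_matD(1)] Kc[THEN carrier_matD(2)]
  have comm: "K1 * K2' = K2 * K1'"
    unfolding K by (rule kron_commute)
  obtain J1 J2 where J [simp]: "J1 \<in> carrier_mat n m" "J2 \<in> carrier_mat n m"
    and JK: "J1 * K1' + J2 * K2' = 1\<^sub>m n"
    using kron_left_inverse[OF pos] unfolding pmn K by metis
  note [simp] = J[THEN carrier_matD(1)] J[THEN carrier_matD(2)]
  obtain G where "\<forall>F1 F2. polynomial_matrix V p m F1 \<longrightarrow> polynomial_matrix V p m F2 \<longrightarrow>
      zariski_open V {x \<in> carrier V. G (F1 x) (F2 x)}"
    and G_ex: "\<exists>A \<in> carrier_mat p m. \<exists>B \<in> carrier_mat p m. G A B"
    and "\<forall>A \<in> carrier_mat p m. \<forall>B \<in> carrier_mat p m. G A B \<longrightarrow>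
      (\<exists>bs \<in> {map Horizontal hs}. pencil_equiv p m A B bs)"
    using gen unfolding generic_pencil_def pmn(1,2)[symmetric] by (elim exE conjE)
  then have G_open: "\<And>F1 F2. polynomial_matrix V p m F1 \<Longrightarrow> polynomial_matrix V p m F2 \<Longrightarrow>
      zariski_open V {x \<in> carrier V. G (F1 x) (F2 x)}"
    and G_equiv: "\<And>A B. A \<in> carrier_mat p m \<Longrightarrow> B \<in> carrier_mat p m \<Longrightarrow> G A B \<Longrightarrow>
      pencil_equiv p m A B (map Horizontal hs)"
    by auto
  have equivE: "\<exists>P P' Q Q'. mutually_inverse p P P' \<and> mutually_inverse m Q Q' \<and>
      A * Q = P * K1 \<and> B * Q = P * K2"
    if "A \<in> carrier_mat p m" "B \<in> carrier_mat p m" "G A B" for A B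
    using G_equiv[OF that] unfolding pencil_equiv_def map_block_Horizontal K by blast
  define D where "D L1 L2 A B = L1 * B + L2 * A" for L1 L2 A B :: "complex mat"
  \<comment> \<open>One formula for both halves of the scaled cokernel rows: the arguments
    \<open>L1\<close>, \<open>E1\<close> yield N1, and \<open>L2\<close>, \<open>E2\<close> yield
    N2.\<close>
  define M where "M L1 L2 E1 E2 L E A B =
    det (D L1 L2 A B) \<cdot>\<^sub>m E - D E1 E2 A B * (adj_mat (D L1 L2 A B) * L)"
    for L1 L2 E1 E2 L E A B :: "complex mat"
  \<comment> \<open>The sign of the second half: annihilation of \<open>(A; B)\<close> reads N1 B +
    N2 A = 0, while \<open>kron_commute\<close> is an equality of two products.\<close>
  define H where "H L1 L2 E1 E2 A B \<longleftrightarrow> det (D L1 L2 A B) \<noteq> 0 \<and>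
    G (M L1 L2 E1 E2 L1 E1 A B) (- M L1 L2 E1 E2 L2 E2 A B)"
    for L1 L2 E1 E2 A B :: "complex mat"
  have Dc: "D L1 L2 A B \<in> carrier_mat k n"
    if "L1 \<in> carrier_mat k m" "L2 \<in> carrier_mat k m" "A \<in> carrier_mat m n" "B \<in> carrier_mat m n"
    for k L1 L2 A B
    using that unfolding D_def by auto
  have Mc: "M L1 L2 E1 E2 L E A B \<in> carrier_mat p m"
    if "L1 \<in> carrier_mat n m" "L2 \<in> carrier_mat n m" "E1 \<in> carrier_mat p m" "E2 \<in> carrier_mat p m"
      "L \<in> carrier_mat n m" "E \<in> carrier_mat p m" "A \<in> carrier_mat m n" "B \<in> carrier_mat m n"
    for L1 L2 E1 E2 L E A B
    using that Dc adj_mat(1)[OF Dc] unfolding M_def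
    by (intro minus_carrier_mat mult_carrier_mat)
  show ?thesis
    unfolding generic_pencil_def pmn(2,3)[symmetric]
  proof (intro exI[of _ "\<lambda>A B. \<exists>L1 \<in> carrier_mat n m. \<exists>L2 \<in> carrier_mat n m.
        \<exists>E1 \<in> carrier_mat p m. \<exists>E2 \<in> carrier_mat p m. H L1 L2 E1 E2 A B"] conjI allI impI ballI)
    fix F1 F2 assume F: "polynomial_matrix V m n F1" "polynomial_matrix V m n F2"
    show "zariski_open V {x \<in> carrier V. \<exists>L1 \<in> carrier_mat n m. \<exists>L2 \<in> carrier_mat n m.
        \<exists>E1 \<in> carrier_mat p m. \<exists>E2 \<in> carrier_mat p m. H L1 L2 E1 E2 (F1 x) (F2 x)}"
    proof (intro zariski_open_Bex)
      fix L1 L2 E1 E2 :: "complex mat"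
      assume c: "L1 \<in> carrier_mat n m" "L2 \<in> carrier_mat n m" "E1 \<in> carrier_mat p m" "E2 \<in> carrier_mat p m"
      note const = polynomial_matrix_const[OF F(1)]
      have D: "polynomial_matrix V k n (\<lambda>x. D X Y (F1 x) (F2 x))"
        if "X \<in> carrier_mat k m" "Y \<in> carrier_mat k m" for X Y k
        unfolding D_def by (intro polynomial_matrix_add polynomial_matrix_mult[OF const F(1)]
            polynomial_matrix_mult[OF const F(2)] that)
      have M: "polynomial_matrix V p m (\<lambda>x. M L1 L2 E1 E2 X E (F1 x) (F2 x))"
        if "X \<in> carrier_mat n m" "E \<in> carrier_mat p m" for X E
        unfolding M_def
        by (rule polynomial_matrix_minus[OF
              polynomial_matrix_smult[OF const[OF that(2)] polynomial_function_det[OF D[OF c(1,2)]]]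
              polynomial_matrix_mult[OF D[OF c(3,4)]
                polynomial_matrix_mult[OF polynomial_matrix_adj[OF D[OF c(1,2)]] const[OF that(1)]]]])
      show "zariski_open V {x \<in> carrier V. H L1 L2 E1 E2 (F1 x) (F2 x)}"
        unfolding H_def
        by (intro zariski_open_conj zariski_open_nonzero polynomial_function_det[OF D[OF c(1,2)]]
            G_open M polynomial_matrix_uminus c)
    qed
  next
    \<comment> \<open>Non-emptiness is shown backwards: from a good p x m pencil
      \<open>(A, B)\<close>, a pencil is built that has it as its cokernel, namely
      \<open>(Q * K1', Q * K2')\<close>.\<close>
    obtain A B where AB: "A \<in> carrier_mat p m" "B \<in> carrier_mat p m" "G A B"
      using G_ex by blast
    obtain P P' Q Q' where PQ: "mutually_inverse p P P'" "mutually_inverse m Q Q'"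
      "A * Q = P * K1" "B * Q = P * K2"
      using equivE[OF AB] by blast
    have PQc [simp]: "P \<in> carrier_mat p p" "P' \<in> carrier_mat p p" "Q \<in> carrier_mat m m" "Q' \<in> carrier_mat m m"
      using PQ by (simp_all add: mutually_inverse_def)
    note [simp] = PQc[THEN carrier_matD(1)] PQc[THEN carrier_matD(2)]
    have cancel: "(X * Q') * (Q * Y) = X * Y"
      if "X \<in> carrier_mat n m" "Y \<in> carrier_mat m n" for X Y
    proof -
      have "(X * Q') * (Q * Y) = X * (Q' * Q * Y)"
        using that by (simp add: mat_mult_assoc_dim)
      then show ?thesis using PQ(2) that by (simp add: mutually_inverse_def)
    qed
    \<comment> \<open>\<open>J1\<close> and \<open>J2\<close> change places because \<open>D\<close>
      pairs its first argument with the second matrix of the pencil. With these choices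
      \<open>?D\<close> is the identity, and \<open>?E\<close> vanishes by \<open>comm\<close>, so
      \<open>M\<close> returns its argument \<open>E\<close> unchanged.\<close>
    let ?D = "D (J2 * Q') (J1 * Q') (Q * K1') (Q * K2')"
    let ?E = "D A (- B) (Q * K1') (Q * K2')"
    have D1: "?D = 1\<^sub>m n"
      using JK comm_add_mat[OF mult_carrier_mat[OF J(1) Kc(3)] mult_carrier_mat[OF J(2) Kc(4)]]
      unfolding D_def by (simp add: cancel)
    have "A * (Q * K2') = P * (K1 * K2')"
      using arg_cong[OF PQ(3), of "\<lambda>Z. Z * K2'"] AB by (simp add: mat_mult_assoc_dim)
    moreover have "B * (Q * K1') = P * (K2 * K1')"
      using arg_cong[OF PQ(4), of "\<lambda>Z. Z * K1'"] AB by (simp add: mat_mult_assoc_dim)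
    ultimately have "A * (Q * K2') = B * (Q * K1')"
      by (simp add: comm)
    then have D2: "?E = 0\<^sub>m p n"
      unfolding D_def using AB by (intro eq_matI) auto
    have MM: "M (J2 * Q') (J1 * Q') A (- B) L E (Q * K1') (Q * K2') = E"
      if "L \<in> carrier_mat n m" "E \<in> carrier_mat p m" for L E
    proof -
      have "adj_mat (1\<^sub>m n :: complex mat) * L \<in> carrier_mat n m"
        by (rule mult_carrier_mat[OF adj_mat(1)[OF one_carrier_mat] that(1)])
      then show ?thesis
        unfolding M_def D1 D2 using that by (intro eq_matI) auto
    qed
    have "H (J2 * Q') (J1 * Q') A (- B) (Q * K1') (Q * K2')"
      unfolding H_def D1 using AB by (subst (1 2) MM) (auto intro!: carrier_matI)
    moreover have "Q * K1' \<in> carrier_mat m n" "Q * K2' \<in> carrier_mat m n"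
      "J1 * Q' \<in> carrier_mat n m" "J2 * Q' \<in> carrier_mat n m" "- B \<in> carrier_mat p m"
      using AB by (auto intro!: carrier_matI)
    ultimately show "\<exists>A\<in>carrier_mat m n. \<exists>B\<in>carrier_mat m n. \<exists>L1\<in>carrier_mat n m. \<exists>L2\<in>carrier_mat n m.
        \<exists>E1\<in>carrier_mat p m. \<exists>E2\<in>carrier_mat p m. H L1 L2 E1 E2 A B"
      using AB(1) by blast
  next
    fix A B assume AB [simp]: "A \<in> carrier_mat m n" "B \<in> carrier_mat m n"
      and EX: "\<exists>L1\<in>carrier_mat n m. \<exists>L2\<in>carrier_mat n m.
        \<exists>E1\<in>carrier_mat p m. \<exists>E2\<in>carrier_mat p m. H L1 L2 E1 E2 A B"
    note [simp] = AB[THEN carrier_matD(1)] AB[THEN carrier_matD(2)]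
    from EX obtain L1 L2 E1 E2 where Lc [simp]: "L1 \<in> carrier_mat n m" "L2 \<in> carrier_mat n m"
      "E1 \<in> carrier_mat p m" "E2 \<in> carrier_mat p m" and H: "H L1 L2 E1 E2 A B" by blast
    note [simp] = Lc[THEN carrier_matD(1)] Lc[THEN carrier_matD(2)]
    define d where "d = det (D L1 L2 A B)"
    define C where "C = adj_mat (D L1 L2 A B)"
    define N1 where "N1 = M L1 L2 E1 E2 L1 E1 A B"
    define N2 where "N2 = M L1 L2 E1 E2 L2 E2 A B"
    have Nc [simp]: "N1 \<in> carrier_mat p m" "N2 \<in> carrier_mat p m"
      unfolding N1_def N2_def by (simp_all add: Mc)
    have d: "d \<noteq> 0" and GN: "G N1 (- N2)"
      using H by (auto simp: H_def d_def N1_def N2_def)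
    have C [simp]: "C \<in> carrier_mat n n" and CD: "C * D L1 L2 A B = d \<cdot>\<^sub>m 1\<^sub>m n"
      using adj_mat[OF Dc[of L1 n L2 A B]] by (simp_all add: C_def d_def)
    note [simp] = C[THEN carrier_matD(1)] C[THEN carrier_matD(2)]
      Nc[THEN carrier_matD(1)] Nc[THEN carrier_matD(2)]
    obtain P P' Q Q' where PQ: "mutually_inverse p P P'" "mutually_inverse m Q Q'"
      "N1 * Q = P * K1" "(- N2) * Q = P * K2"
      using equivE[of N1 "- N2"] GN by auto
    have PQc [simp]: "P \<in> carrier_mat p p" "P' \<in> carrier_mat p p" "Q \<in> carrier_mat m m" "Q' \<in> carrier_mat m m"
      using PQ by (simp_all add: mutually_inverse_def)
    note [simp] = PQc[THEN carrier_matD(1)] PQc[THEN carrier_matD(2)]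
    have PP: "P * P' = 1\<^sub>m p" and QQ: "Q' * Q = 1\<^sub>m m"
      using PQ by (simp_all add: mutually_inverse_def)
    let ?c = "1 / d"
    \<comment> \<open>Dividing by \<open>d\<close> turns the adjugate into the inverse of
      \<open>D L1 L2 A B\<close>, so that \<open>(L2', L1')\<close> is an exact left inverse of
      \<open>(A; B)\<close>.\<close>
    define L1' where "L1' = ?c \<cdot>\<^sub>m (C * L1)"
    define L2' where "L2' = ?c \<cdot>\<^sub>m (C * L2)"
    have L'c [simp]: "L1' \<in> carrier_mat n m" "L2' \<in> carrier_mat n m"
      by (auto simp: L1'_def L2'_def intro!: carrier_matI)
    note [simp] = L'c[THEN carrier_matD(1)] L'c[THEN carrier_matD(2)]
    have CLB: "C * L1 * B + C * L2 * A = d \<cdot>\<^sub>m 1\<^sub>m n"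
      using CD unfolding D_def
      by (simp add: mat_distrib_left_dim mat_mult_assoc_dim)
    have LD: "L1' * B + L2' * A = 1\<^sub>m n"
    proof -
      have "L1' * B + L2' * A = ?c \<cdot>\<^sub>m (C * L1 * B + C * L2 * A)"
        unfolding L1'_def L2'_def
        by (simp add: mat_smult_mult_dim mat_smult_add_dim)
      also have "\<dots> = 1\<^sub>m n" unfolding CLB using d by (intro eq_matI) auto
      finally show ?thesis .
    qed
    define E where "E = D E1 E2 A B"
    have E [simp]: "E \<in> carrier_mat p n" unfolding E_def by (simp add: Dc)
    note [simp] = E[THEN carrier_matD(1)] E[THEN carrier_matD(2)]
    have ND: "N1 * B + N2 * A = 0\<^sub>m p n"
    proof -
      have "N1 * B + N2 * A =
          (d \<cdot>\<^sub>m (E1 * B) - E * (C * L1 * B)) + (d \<cdot>\<^sub>m (E2 * A) - E * (C * L2 * A))"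
        unfolding N1_def N2_def M_def d_def[symmetric] C_def[symmetric] E_def[symmetric]
        by (simp add: mat_diff_distrib_right_dim mat_smult_mult_dim mat_mult_assoc_dim)
      also have "\<dots> = d \<cdot>\<^sub>m (E1 * B + E2 * A) - (E * (C * L1 * B) + E * (C * L2 * A))"
        by (rule eq_matI) (auto simp: algebra_simps simp del: index_mult_mat(1))
      also have "E * (C * L1 * B) + E * (C * L2 * A) = E * (C * L1 * B + C * L2 * A)"
        by (rule mat_distrib_left_dim[symmetric]) simp_all
      also have "E * (C * L1 * B + C * L2 * A) = d \<cdot>\<^sub>m E"
        unfolding CLB by (simp add: mat_smult_mult_dim)
      finally show ?thesis
        using minus_r_inv_mat[OF smult_carrier_mat[OF E], of d] by (simp add: E_def D_def)
    qed
    let ?X1 = "Q * K1'" and ?X2 = "Q * K2'"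
    \<comment> \<open>A right inverse of \<open>N1\<close>, which is \<open>P * K1 * Q'\<close>,
      since \<open>K1\<close> has orthonormal rows.\<close>
    let ?Y = "Q * (transpose_mat K1 * P')"
    have T [simp]: "transpose_mat K1 \<in> carrier_mat m p" by simp
    have "N1 * ?Y = P * (K1 * transpose_mat K1) * P'"
      using arg_cong[OF PQ(3), of "\<lambda>Z. Z * (transpose_mat K1 * P')"] by (simp add: mat_mult_assoc_dim)
    also have "\<dots> = 1\<^sub>m p"
      unfolding K(1) kron_right_inverse by (simp add: pmn(1)[symmetric] PP)
    finally have NY: "N1 * ?Y = 1\<^sub>m p" .
    have "N1 * ?X2 = P * (K1 * K2')"
      using arg_cong[OF PQ(3), of "\<lambda>Z. Z * K2'"] by (simp add: mat_mult_assoc_dim)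
    moreover have "(- N2) * ?X1 = P * (K2 * K1')"
      using arg_cong[OF PQ(4), of "\<lambda>Z. Z * K1'"]
      by (simp add: mat_mult_assoc_dim del: uminus_mult_left_mat)
    ultimately have eq: "N1 * ?X2 = (- N2) * ?X1" by (simp add: comm)
    have NX: "N1 * ?X2 + N2 * ?X1 = 0\<^sub>m p n"
      unfolding eq by (rule eq_matI) (simp_all del: index_mult_mat(1))
    \<comment> \<open>The coefficients of \<open>(?X1; ?X2)\<close> in the columns of
      \<open>(A; B)\<close>, read off with the left inverse.\<close>
    define R where "R = L1' * ?X2 + L2' * ?X1"
    have R [simp]: "R \<in> carrier_mat n n" unfolding R_def by (auto intro!: carrier_matI)
    note [simp] = R[THEN carrier_matD(1)] R[THEN carrier_matD(2)]
    have Yc: "?Y \<in> carrier_mat m p" and Xc: "?X1 \<in> carrier_mat m n" "?X2 \<in> carrier_mat m n"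
      by (auto intro!: carrier_matI)
    have AR: "A * R = ?X1" and BR: "B * R = ?X2"
      unfolding R_def
      by (rule kernel_factorization[of A m n B L1' L2' N1 p N2 ?Y _ n];
          (rule LD ND NY NX dim Yc Xc)?; simp)+
    \<comment> \<open>The left inverse \<open>(J1, J2)\<close> of the raised blocks, transported
      along \<open>Q'\<close>, inverts \<open>R\<close>.\<close>
    define S where "S = J1 * Q' * A + J2 * Q' * B"
    have [simp]: "S \<in> carrier_mat n n" unfolding S_def by (auto intro!: carrier_matI)
    have cancel: "X * Q' * Z * R = X * Y"
      if "X \<in> carrier_mat n m" "Y \<in> carrier_mat m n" "Z * R = Q * Y" "Z \<in> carrier_mat m n" for X Y Z
    proof -
      have "X * Q' * Z * R = X * (Q' * (Z * R))"
        using that(1,2,4) by (simp add: mat_mult_assoc_dim R[THEN carrier_matD(1)])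
      also have "\<dots> = X * (Q' * Q * Y)"
        using that by (simp add: mat_mult_assoc_dim)
      finally show ?thesis using QQ that by simp
    qed
    have "S * R = J1 * Q' * A * R + J2 * Q' * B * R"
      unfolding S_def by (rule add_mult_distrib_mat) (auto intro!: carrier_matI)
    also have "\<dots> = 1\<^sub>m n"
      using JK by (simp add: cancel[OF _ _ AR] cancel[OF _ _ BR])
    finally have "mutually_inverse n R S"
      by (intro mutually_inverse_sym[OF mutually_inverseI]) auto
    then have "pencil_equiv m n A B (map Horizontal (map Suc hs))"
      unfolding pencil_equiv_def map_block_Horizontal K(3,4)[symmetric]
      using AR BR PQ(2) Kc by blast
    then show "\<exists>bs\<in>{map Horizontal (map Suc hs)}. pencil_equiv m n A B bs" by blast
  qed
qed

text \<open>Every step raises all widths by one, so the widths 1 and 2 end as q + 1 and q + 2. They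
  stay positive, as the step demands.\<close>

lemma generic_pencil_horizontal:
  assumes "set hs \<subseteq> {1, 2}"
  shows "generic_pencil V (height (map ((+) q) hs)) (sum_list (map ((+) q) hs))
    {map Horizontal (map ((+) q) hs)}"
proof (induction q)
  case 0
  show ?case using generic_pencil_base[OF assms] by (simp add: map_idI)
next
  case (Suc q)
  have *: "map ((+) (Suc q)) hs = map Suc (map ((+) q) hs)" by simp
  have "0 \<notin> set (map ((+) q) hs)" using assms by auto
  from generic_pencil_step[OF this Suc] show ?case
    unfolding * height_Suc .
qed

text \<open>Transposing \<open>A * Q = P * K\<close> directly puts the base changes on the wrong
  sides. Transposing \<open>P' * A = K * Q'\<close> instead gives the required form, with inverse
  transposes as base changes.\<close>

lemma pencil_equiv_transpose:
  assumes A: "A \<in> carrier_mat m n" and B: "B \<in> carrier_mat m n"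
    and equiv: "pencil_equiv m n A B (map Horizontal hs)"
  shows "pencil_equiv n m (transpose_mat A) (transpose_mat B) (map Vertical hs)"
proof -
  obtain P P' Q Q' where inv: "mutually_inverse m P P'" "mutually_inverse n Q Q'"
    and K: "kron_fst hs \<in> carrier_mat m n" "kron_snd hs \<in> carrier_mat m n"
    and eq: "A * Q = P * kron_fst hs" "B * Q = P * kron_snd hs"
    using equiv unfolding pencil_equiv_def map_block_Horizontal by blast
  have c: "P \<in> carrier_mat m m" "P' \<in> carrier_mat m m" "Q \<in> carrier_mat n n" "Q' \<in> carrier_mat n n"
    and 1: "P' * P = 1\<^sub>m m" "Q * Q' = 1\<^sub>m n" "P * P' = 1\<^sub>m m" "Q' * Q = 1\<^sub>m n"
    using inv by (auto simp: mutually_inverse_def)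
  note d = c[THEN carrier_matD(1)] c[THEN carrier_matD(2)]
  have *: "transpose_mat X * transpose_mat P' = transpose_mat Q' * transpose_mat K"
    if "X * Q = P * K" "X \<in> carrier_mat m n" "K \<in> carrier_mat m n" for X K
  proof -
    have "P' * (X * Q) * Q' = P' * X * (Q * Q')"
      using d that(2) by (simp add: mat_mult_assoc_dim)
    then have "P' * X = P' * (X * Q) * Q'"
      using d that(2) unfolding 1 by simp
    also have "\<dots> = P' * P * K * Q'"
      unfolding that(1) using d that(3) by (simp add: mat_mult_assoc_dim)
    also have "\<dots> = K * Q'" using that(3) unfolding 1 by simp
    finally have "transpose_mat (P' * X) = transpose_mat (K * Q')" by simp
    then show ?thesis
      using transpose_mult[OF c(2) that(2)] transpose_mult[OF that(3) c(4)] by simp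
  qed
  have "mutually_inverse n (transpose_mat Q') (transpose_mat Q)"
    "mutually_inverse m (transpose_mat P') (transpose_mat P)"
    using c 1 by (auto simp: mutually_inverse_def simp flip: transpose_mult)
  moreover have "diag_block_mat (map block_fst (map Vertical hs)) = transpose_mat (kron_fst hs)"
    "diag_block_mat (map block_snd (map Vertical hs)) = transpose_mat (kron_snd hs)"
    by (simp_all add: kron_fst_def kron_snd_def diag_block_mat_transpose comp_def)
  moreover have "transpose_mat (kron_fst hs) \<in> carrier_mat n m" "transpose_mat (kron_snd hs) \<in> carrier_mat n m"
    using K by simp_all
  ultimately show ?thesis
    unfolding pencil_equiv_def using *[OF eq(1) A K(1)] *[OF eq(2) B K(2)] by metis
qed

section \<open>The square case\<close>

definition trace :: "'a :: comm_monoid_add mat \<Rightarrow> 'a" where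
  "trace A = (\<Sum>i<dim_row A. A $$ (i, i))"

lemma trace_mult_commute:
  fixes A B :: "complex mat"
  assumes "A \<in> carrier_mat n m" "B \<in> carrier_mat m n"
  shows "trace (A * B) = trace (B * A)"
proof -
  have "trace (A * B) = (\<Sum>i<n. \<Sum>j<m. A $$ (i, j) * B $$ (j, i))"
    using assms by (simp add: trace_def mat_mult_index_sum[of _ n m _ n] del: index_mult_mat(1))
  also have "\<dots> = (\<Sum>j<m. \<Sum>i<n. A $$ (i, j) * B $$ (j, i))" by (rule sum.swap)
  also have "\<dots> = trace (B * A)"
    using assms by (simp add: trace_def mat_mult_index_sum[of _ m n _ m] mult.commute del: index_mult_mat(1))
  finally show ?thesis .
qed

lemma upper_triangular_pow:
  fixes J :: "complex mat"
  assumes J: "J \<in> carrier_mat n n" "\<And>i j. j < i \<Longrightarrow> i < n \<Longrightarrow> J $$ (i, j) = 0"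
  shows "(\<forall>i<n. \<forall>j<i. (J ^\<^sub>m k) $$ (i, j) = 0) \<and> (\<forall>i<n. (J ^\<^sub>m k) $$ (i, i) = (J $$ (i, i)) ^ k)"
proof (induction k)
  case 0
  then show ?case using J(1) by auto
next
  case (Suc k)
  have c: "J ^\<^sub>m k \<in> carrier_mat n n" using J(1) by simp
  have "(\<Sum>l<n. (J ^\<^sub>m k) $$ (i, l) * J $$ (l, j)) = (if j = i then (J $$ (i, i)) ^ Suc k else 0)"
    if "i < n" "j \<le> i" for i j
  proof -
    have "(J ^\<^sub>m k) $$ (i, l) * J $$ (l, j) = (if l = i then if j = i then (J $$ (i, i)) ^ Suc k else 0 else 0)"
      if "l < n" for l
      using that \<open>i < n\<close> \<open>j \<le> i\<close> Suc J(2) by (cases l i rule: linorder_cases) auto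
    then have "(\<Sum>l<n. (J ^\<^sub>m k) $$ (i, l) * J $$ (l, j)) =
        (\<Sum>l<n. if l = i then if j = i then (J $$ (i, i)) ^ Suc k else 0 else 0)"
      by (intro sum.cong) auto
    then show ?thesis using that by simp
  qed
  then show ?case
    using mat_mult_index_sum[OF c J(1)] by (simp del: index_mult_mat(1))
qed

lemma trace_upper_triangular_pow:
  fixes J :: "complex mat"
  assumes "J \<in> carrier_mat n n" "\<And>i j. j < i \<Longrightarrow> i < n \<Longrightarrow> J $$ (i, j) = 0"
  shows "trace (J ^\<^sub>m k) = (\<Sum>i<n. (J $$ (i, i)) ^ k)"
proof -
  have "dim_row (J ^\<^sub>m k) = n" using assms(1) by simp
  then show ?thesis
    using upper_triangular_pow[of J n k] assms by (simp add: trace_def)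
qed

text \<open>The Vandermonde matrix with nodes x 0, ..., x (n - 1).\<close>

definition power_matrix :: "nat \<Rightarrow> (nat \<Rightarrow> complex) \<Rightarrow> complex mat" where
  "power_matrix n x = mat n n (\<lambda>(k, j). x k ^ j)"

text \<open>A kernel vector is the coefficient list of a non-zero polynomial of degree below n that
  vanishes at all nodes, so the n nodes cannot be distinct. Conversely, equal nodes give equal
  rows.\<close>

lemma det_power_matrix_eq_0_iff:
  "det (power_matrix n x) = 0 \<longleftrightarrow> \<not> inj_on x {..<n}"
proof
  have V: "power_matrix n x \<in> carrier_mat n n" by (simp add: power_matrix_def)
  show "det (power_matrix n x) = 0" if not_inj: "\<not> inj_on x {..<n}"
  proof -
    obtain i j where "i < n" "j < n" "i \<noteq> j" "x i = x j"
      using not_inj by (meson inj_onI lessThan_iff)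
    then show ?thesis
      by (intro det_identical_rows[OF V, of i j]) (auto simp: power_matrix_def)
  qed
  assume "det (power_matrix n x) = 0"
  then obtain v where v: "v \<in> carrier_vec n" "v \<noteq> 0\<^sub>v n" "power_matrix n x *\<^sub>v v = 0\<^sub>v n"
    using det_0_iff_vec_prod_zero_field[OF V] by blast
  define p where "p = (\<Sum>j<n. monom (v $ j) j)"
  have coeff: "coeff p j = (if j < n then v $ j else 0)" for j
    by (simp add: p_def coeff_sum)
  have "p \<noteq> 0"
  proof
    assume "p = 0"
    then have "v = 0\<^sub>v n" using v(1) coeff by (intro eq_vecI) (auto, metis coeff_0)
    with v show False by simp
  qed
  have n: "n > 0" using v by (cases n) auto
  have "poly p (x k) = 0" if "k < n" for k
  proof -
    have "(power_matrix n x *\<^sub>v v) $ k = (\<Sum>j<n. x k ^ j * v $ j)"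
      using v(1) that by (simp add: power_matrix_def scalar_prod_def lessThan_atLeast0)
    then show ?thesis using that unfolding v(3) by (simp add: p_def poly_sum poly_monom mult.commute)
  qed
  then have "x ` {..<n} \<subseteq> {y. poly p y = 0}" by auto
  then have "card (x ` {..<n}) \<le> card {y. poly p y = 0}"
    by (intro card_mono poly_roots_finite \<open>p \<noteq> 0\<close>)
  also have "\<dots> \<le> degree p" by (rule card_poly_roots_bound[OF \<open>p \<noteq> 0\<close>])
  also have "degree p < n"
    using n by (intro degree_lessI) (auto simp: coeff)
  finally show "\<not> inj_on x {..<n}"
    using card_image[of x "{..<n}"] by auto
qed

text \<open>The determinant of the matrix of power sums of the eigenvalues, which is the discriminant
  of the characteristic polynomial.\<close>

definition discriminant :: "nat \<Rightarrow> complex mat \<Rightarrow> complex" where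
  "discriminant n M = det (mat n n (\<lambda>(i, j). trace (M ^\<^sub>m (i + j))))"

text \<open>Traces of powers are invariant under similarity, and for triangular \<open>J\<close>
  they are the power sums of its diagonal. The Hankel matrix is therefore the transposed Vandermonde
  matrix times itself, and its determinant is a square.\<close>

lemma discriminant_eq_0_iff:
  assumes M: "M \<in> carrier_mat n n" and M': "similar_mat M J"
    and J: "\<And>i j. j < i \<Longrightarrow> i < n \<Longrightarrow> J $$ (i, j) = 0"
  shows "discriminant n M = 0 \<longleftrightarrow> \<not> inj_on (\<lambda>i. J $$ (i, i)) {..<n}"
proof -
  obtain P Q where PQ: "similar_mat_wit M J P Q"
    using M' unfolding similar_mat_def by blast
  have n: "n = dim_row M" using M by auto
  note w = similar_mat_witD[OF n PQ]
  have tr: "trace (M ^\<^sub>m k) = (\<Sum>i<n. (J $$ (i, i)) ^ k)" for k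
  proof -
    have Jk: "J ^\<^sub>m k \<in> carrier_mat n n" using w(5) by simp
    have "trace (M ^\<^sub>m k) = trace (P * (J ^\<^sub>m k * Q))"
      using similar_mat_wit_pow_id[OF PQ, of k] assoc_mult_mat[OF w(6) Jk w(7)] by simp
    also have "\<dots> = trace (J ^\<^sub>m k * Q * P)"
      by (rule trace_mult_commute[OF w(6) mult_carrier_mat[OF Jk w(7)]])
    also have "J ^\<^sub>m k * Q * P = J ^\<^sub>m k"
      using assoc_mult_mat[OF Jk w(7,6)] right_mult_one_mat[OF Jk] w(2) by simp
    finally show ?thesis using trace_upper_triangular_pow[OF w(5) J] by simp
  qed
  define V where "V = power_matrix n (\<lambda>i. J $$ (i, i))"
  have V: "V \<in> carrier_mat n n" by (simp add: V_def power_matrix_def)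
  have "mat n n (\<lambda>(i, j). trace (M ^\<^sub>m (i + j))) = transpose_mat V * V"
    by (rule eq_matI) (simp_all add: V_def power_matrix_def tr scalar_prod_def power_add lessThan_atLeast0)
  then have "discriminant n M = det V * det V"
    unfolding discriminant_def using det_mult[of "transpose_mat V" n V] V by (simp add: det_transpose)
  then show ?thesis using det_power_matrix_eq_0_iff by (simp add: V_def)
qed

section \<open>Jordan forms with distinct eigenvalues\<close>

lemma diag_mat_jordan_matrix:
  "map (\<lambda>i. jordan_matrix n_as $$ (i, i)) [0..<sum_list (map fst n_as)] =
    concat (map (\<lambda>(n, a). replicate n a) n_as)"
proof (induction n_as)
  case (Cons na n_as)
  obtain n a where na: "na = (n, a)" by force
  have d: "dim_row (jordan_matrix n_as) = sum_list (map fst n_as)"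
    "dim_col (jordan_matrix n_as) = sum_list (map fst n_as)" by simp_all
  have J: "jordan_matrix (na # n_as) = four_block_mat (jordan_block n a)
      (0\<^sub>m n (sum_list (map fst n_as))) (0\<^sub>m (sum_list (map fst n_as)) n) (jordan_matrix n_as)"
    using d by (simp add: jordan_matrix_def na Let_def)
  have "map (\<lambda>i. jordan_matrix (na # n_as) $$ (i, i)) [0..<n] = replicate n a"
    unfolding J by (rule nth_equalityI) (simp_all add: jordan_block_def)
  moreover have "map (\<lambda>i. jordan_matrix (na # n_as) $$ (i, i)) [n..<n + sum_list (map fst n_as)] =
      concat (map (\<lambda>(n, a). replicate n a) n_as)"
    unfolding Cons[symmetric] unfolding J by (rule nth_equalityI) simp_all
  ultimately show ?case
    by (simp add: na upt_add_eq_append[of 0])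
qed simp

text \<open>Both a block of size at least 2 and a second block with the same eigenvalue would repeat
  an entry of the diagonal.\<close>

lemma simple_jordan_blocks:
  assumes "0 \<notin> fst ` set n_as" "distinct (concat (map (\<lambda>(n, a). replicate n a) n_as))"
  shows "n_as = map (Pair 1) (map snd n_as)" "distinct (map snd n_as)"
proof -
  have "n_as = map (Pair 1) (map snd n_as) \<and>
    concat (map (\<lambda>(n, a). replicate n a) n_as) = map snd n_as"
    using assms
  proof (induction n_as)
    case (Cons na n_as)
    obtain n a where na: "na = (n, a)" by force
    have "distinct (replicate n a)" "n \<noteq> 0" using Cons.prems by (auto simp: na)
    then have "n = 1" by (cases n rule: nat.exhaust; cases "n - 1") auto
    with Cons na show ?case by auto
  qed simp
  with assms(2) show "n_as = map (Pair 1) (map snd n_as)" "distinct (map snd n_as)" by auto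
qed

lemma diagonalizable_if_discriminant:
  assumes M: "M \<in> carrier_mat n n" and disc: "discriminant n M \<noteq> 0"
  obtains P P' as where "mutually_inverse n P P'" "length as = n" "distinct as"
    "M * P = P * jordan_matrix (map (Pair 1) as)"
proof -
  obtain as' where "char_poly M = (\<Prod>a\<leftarrow>as'. [:- a, 1:])"
    using char_poly_factorized[OF M] by blast
  then obtain n_as where n_as: "0 \<notin> fst ` set n_as" and sim: "similar_mat M (jordan_matrix n_as)"
    using jordan_nf_exists[OF M] unfolding jordan_nf_def by blast
  have n: "n = dim_row M" using M by auto
  obtain P Q where PQ: "similar_mat_wit M (jordan_matrix n_as) P Q"
    using sim unfolding similar_mat_def by blast
  note w = similar_mat_witD[OF n PQ]
  have size: "sum_list (map fst n_as) = n" using w(5) by auto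
  have "inj_on (\<lambda>i. jordan_matrix n_as $$ (i, i)) {..<n}"
    using disc discriminant_eq_0_iff[OF M sim] jordan_matrix_upper_triangular[of _ n_as] size by auto
  then have "distinct (map (\<lambda>i. jordan_matrix n_as $$ (i, i)) [0..<sum_list (map fst n_as)])"
    by (simp add: distinct_map size lessThan_atLeast0)
  from simple_jordan_blocks[OF n_as this[unfolded diag_mat_jordan_matrix]]
  have as: "n_as = map (Pair 1) (map snd n_as)" "distinct (map snd n_as)" .
  have "sum_list (map fst n_as) = length n_as" by (subst as(1)) (simp add: comp_def sum_list_triv)
  with size have "length (map snd n_as) = n" by simp
  moreover have "mutually_inverse n P Q" using w by (simp add: mutually_inverse_def)
  moreover have "M * P = P * jordan_matrix n_as"
  proof -
    have "M * P = P * jordan_matrix n_as * (Q * P)"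
      unfolding w(3) by (rule assoc_mult_mat[OF mult_carrier_mat[OF w(6,5)] w(7,6)])
    then show ?thesis unfolding w(2) right_mult_one_mat[OF mult_carrier_mat[OF w(6,5)]] .
  qed
  ultimately show thesis using that[of P Q "map snd n_as"] as by metis
qed

lemma mutually_inverse_mult:
  assumes "mutually_inverse n P P'" "mutually_inverse n Q Q'"
  shows "mutually_inverse n (P * Q) (Q' * P')"
proof (rule mutually_inverseI)
  have c: "P \<in> carrier_mat n n" "P' \<in> carrier_mat n n" "Q \<in> carrier_mat n n" "Q' \<in> carrier_mat n n"
    and 1: "P * P' = 1\<^sub>m n" "Q * Q' = 1\<^sub>m n"
    using assms by (auto simp: mutually_inverse_def)
  show "P * Q \<in> carrier_mat n n" "Q' * P' \<in> carrier_mat n n" using c by auto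
  have "P * Q * (Q' * P') = P * (Q * Q' * P')"
    using c[THEN carrier_matD(1)] c[THEN carrier_matD(2)] by (simp add: mat_mult_assoc_dim)
  then show "P * Q * (Q' * P') = 1\<^sub>m n" using c by (simp add: 1)
qed

lemma diag_block_mat_jordan_1:
  "diag_block_mat (map (\<lambda>a. jordan_block 1 a) as) =
    mat (length as) (length as) (\<lambda>(i, j). if i = j then as ! i else 0)"
proof (induction as)
  case (Cons a as)
  show ?case
    unfolding list.simps diag_block_mat.simps Let_def Cons
    by (rule eq_matI) (auto simp: jordan_block_def nth_Cons split: nat.split)
qed auto

definition simple_eigenvalues :: "complex list \<Rightarrow> pencil_block list" where
  "simple_eigenvalues as = map (\<lambda>a. Jordan (Finite a) 1) as"

lemma diag_block_mat_simple_eigenvalues: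
  "diag_block_mat (map block_fst (simple_eigenvalues as)) =
    mat (length as) (length as) (\<lambda>(i, j). if i = j then as ! i else 0)"
  "diag_block_mat (map block_snd (simple_eigenvalues as)) = 1\<^sub>m (length as)"
  using diag_block_mat_jordan_1[of as] diag_block_mat_one[of "\<lambda>_. 1" as]
  by (simp_all add: simple_eigenvalues_def comp_def sum_list_triv)

lemma jordan_matrix_Pair_1:
  "jordan_matrix (map (Pair 1) as) =
    mat (length as) (length as) (\<lambda>(i, j). if i = j then as ! i else 0)"
  using diag_block_mat_jordan_1[of as] by (simp add: jordan_matrix_def comp_def)

lemma polynomial_function_trace:
  assumes F: "polynomial_matrix V p p F"
  shows "(\<lambda>x. trace (F x)) \<in> polynomial_functions V"
proof (rule polynomial_function_cong[OF F])
  show "(\<lambda>x. \<Sum>i<p. F x $$ (i, i)) \<in> polynomial_functions V"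
    by (intro polynomial_functions_sum polynomial_matrix_entry[OF F]) auto
qed (use carrier_matD[OF polynomial_matrix_carrier[OF F]] in \<open>auto simp: trace_def\<close>)

lemma polynomial_function_discriminant:
  assumes F: "polynomial_matrix V p p F"
  shows "(\<lambda>x. discriminant p (F x)) \<in> polynomial_functions V"
  unfolding discriminant_def
proof (rule polynomial_function_det, rule polynomial_matrixI[OF F,
      where g = "\<lambda>i j x. trace (F x ^\<^sub>m (i + j))"])
  show "(\<lambda>x. trace (F x ^\<^sub>m (i + j))) \<in> polynomial_functions V" for i j
    by (intro polynomial_function_trace[of _ p] polynomial_matrix_pow F)
qed auto

text \<open>An invertible \<open>B\<close> rules out the eigenvalue infinity. Eigenvectors of the
  inverse of \<open>B\<close> times \<open>A\<close> as source basis, and their images under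
  \<open>B\<close> as target basis, make \<open>B\<close> the identity and \<open>A\<close>
  diagonal. The adjugate stands in for the inverse to keep the condition polynomial.\<close>

lemma generic_pencil_square:
  "generic_pencil V n n {simple_eigenvalues as | as. distinct as \<and> length as = n}"
  unfolding generic_pencil_def
proof (intro exI[of _ "\<lambda>A B. det B \<noteq> 0 \<and> discriminant n (adj_mat B * A) \<noteq> 0"] conjI allI impI ballI)
  fix F1 F2 assume F: "polynomial_matrix V n n F1" "polynomial_matrix V n n F2"
  show "zariski_open V {x \<in> carrier V. det (F2 x) \<noteq> 0 \<and> discriminant n (adj_mat (F2 x) * F1 x) \<noteq> 0}"
    by (intro zariski_open_conj zariski_open_nonzero polynomial_function_det[OF F(2)]
        polynomial_function_discriminant polynomial_matrix_mult[OF polynomial_matrix_adj[OF F(2)] F(1)])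
next
  \<comment> \<open>A point of the open set: distinct diagonal entries 0, ..., n - 1 for
    \<open>A\<close>, and the identity, which is its own adjugate, for \<open>B\<close>.\<close>
  define A :: "complex mat" where "A = mat n n (\<lambda>(i, j). if i = j then of_nat i else 0)"
  have A: "A \<in> carrier_mat n n" by (simp add: A_def)
  have "inj_on (\<lambda>i. A $$ (i, i)) {..<n}" by (auto simp: inj_on_def A_def)
  moreover have "similar_mat A A" using A by (rule similar_mat_refl)
  ultimately have "discriminant n A \<noteq> 0"
    using discriminant_eq_0_iff[OF A, of A] by (auto simp: A_def)
  moreover have "adj_mat (1\<^sub>m n) = (1\<^sub>m n :: complex mat)"
    using adj_mat(1,3)[OF one_carrier_mat[of n], where 'a = complex] by (auto intro: eq_matI)
  then have "adj_mat (1\<^sub>m n) * A = A" using A by simp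
  ultimately show "\<exists>A\<in>carrier_mat n n. \<exists>B\<in>carrier_mat n n.
      det B \<noteq> 0 \<and> discriminant n (adj_mat B * A) \<noteq> 0"
    using A by (intro bexI[of _ A] bexI[of _ "1\<^sub>m n"]) auto
next
  fix A B :: "complex mat"
  assume A: "A \<in> carrier_mat n n" and B: "B \<in> carrier_mat n n"
    and AB: "det B \<noteq> 0 \<and> discriminant n (adj_mat B * A) \<noteq> 0"
  define d where "d = det B"
  define M where "M = adj_mat B * A"
  have d: "d \<noteq> 0" using AB by (simp add: d_def)
  have M: "M \<in> carrier_mat n n" unfolding M_def by (rule mult_carrier_mat[OF adj_mat(1)[OF B] A])
  obtain P P' as where P: "mutually_inverse n P P'" and as: "length as = n" "distinct as"
    and MP: "M * P = P * jordan_matrix (map (Pair 1) as)"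
    using diagonalizable_if_discriminant[OF M] AB unfolding M_def by blast
  obtain B' where B': "mutually_inverse n B B'"
    using mutually_inverse_det[OF B] AB by blast
  define D where "D = jordan_matrix (map (Pair 1) as)"
  \<comment> \<open>The adjugate is \<open>d\<close> times the inverse, so the eigenvalues of
    \<open>M\<close> are \<open>d\<close> times those of the pencil; rescaling by a non-zero factor
    keeps them distinct.\<close>
  define bs where "bs = map (\<lambda>a. a / d) as"
  have K: "diag_block_mat (map block_fst (simple_eigenvalues bs)) = (1 / d) \<cdot>\<^sub>m D"
    "diag_block_mat (map block_snd (simple_eigenvalues bs)) = 1\<^sub>m n"
    unfolding diag_block_mat_simple_eigenvalues D_def jordan_matrix_Pair_1
    using as by (auto simp: bs_def intro!: eq_matI)
  have Pc: "P \<in> carrier_mat n n" using P by (simp add: mutually_inverse_def)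
  have Dc: "D \<in> carrier_mat n n" using as unfolding D_def jordan_matrix_Pair_1 by simp
  note [simp] = A[THEN carrier_matD(1)] A[THEN carrier_matD(2)] B[THEN carrier_matD(1)] B[THEN carrier_matD(2)]
    Pc[THEN carrier_matD(1)] Pc[THEN carrier_matD(2)] Dc[THEN carrier_matD(1)] Dc[THEN carrier_matD(2)]
    adj_mat(1)[OF B, THEN carrier_matD(1)] adj_mat(1)[OF B, THEN carrier_matD(2)]
  have "B * (M * P) = (B * adj_mat B) * (A * P)"
    by (simp add: M_def mat_mult_assoc_dim)
  also have "\<dots> = d \<cdot>\<^sub>m (A * P)"
    unfolding adj_mat(2)[OF B] by (simp add: d_def mat_smult_mult_dim)
  finally have "d \<cdot>\<^sub>m (A * P) = B * P * D"
    unfolding MP D_def[symmetric] by (simp add: mat_mult_assoc_dim)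
  then have "(1 / d) \<cdot>\<^sub>m (d \<cdot>\<^sub>m (A * P)) = (1 / d) \<cdot>\<^sub>m (B * P * D)" by simp
  moreover have "(1 / d) \<cdot>\<^sub>m (d \<cdot>\<^sub>m X) = X" for X using d by (intro eq_matI) auto
  ultimately have "A * P = B * P * ((1 / d) \<cdot>\<^sub>m D)"
    by (simp add: mat_smult_mult_dim)
  moreover have "B * P = B * P * 1\<^sub>m n" by simp
  moreover have "(1 / d) \<cdot>\<^sub>m D \<in> carrier_mat n n" "1\<^sub>m n \<in> carrier_mat n n" using Dc by simp_all
  ultimately have "pencil_equiv n n A B (simple_eigenvalues bs)"
    unfolding pencil_equiv_def K using mutually_inverse_mult[OF B' P] P by metis
  moreover have "distinct bs" "length bs = n"
    using as d by (auto simp: bs_def distinct_map inj_on_def)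
  ultimately show "\<exists>bs\<in>{simple_eigenvalues as |as. distinct as \<and> length as = n}. pencil_equiv n n A B bs"
    by blast
qed

section \<open>Types of blocks and the invariants\<close>

lemma mset_concat_map_concat_replicate:
  "mset (concat (map f (concat (replicate n xs)))) = repeat_mset n (mset (concat (map f xs)))"
  by (induction n) simp_all

lemma concat_map_Nil: "concat (map (\<lambda>_. []) xs) = []"
  by (induction xs) simp_all

lemma type_of_blocks_Horizontal:
  "type_of_blocks (concat (replicate n (map Horizontal hs))) =
    \<lparr> jordan_sizes = {#}, horizontal_indices = repeat_mset n (mset hs), vertical_indices = {#} \<rparr>"
proof -
  have "eigenvalues_of (concat (replicate n (map Horizontal hs))) = {}"
    by (auto simp: eigenvalues_of_def)
  then show ?thesis
    by (simp add: type_of_blocks_def mset_concat_map_concat_replicate comp_def concat_map_Nil)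
qed

lemma type_of_blocks_Vertical:
  "type_of_blocks (concat (replicate n (map Vertical vs))) =
    \<lparr> jordan_sizes = {#}, horizontal_indices = {#}, vertical_indices = repeat_mset n (mset vs) \<rparr>"
proof -
  have "eigenvalues_of (concat (replicate n (map Vertical vs))) = {}"
    by (auto simp: eigenvalues_of_def)
  then show ?thesis
    by (simp add: type_of_blocks_def mset_concat_map_concat_replicate comp_def concat_map_Nil)
qed

text \<open>All copies carry the same eigenvalues, so repetition adds blocks to each eigenvalue and
  creates no new ones. The eigenvalues occur at all only because n is positive.\<close>

lemma type_of_blocks_simple_eigenvalues:
  assumes "0 < n" "distinct as"
  shows "type_of_blocks (concat (replicate n (simple_eigenvalues as))) =
    \<lparr> jordan_sizes = replicate_mset (length as) (replicate_mset n 1),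
      horizontal_indices = {#}, vertical_indices = {#} \<rparr>"
proof -
  have e: "eigenvalues_of (concat (replicate n (simple_eigenvalues as))) = Finite ` set as"
    using assms(1) by (auto simp: eigenvalues_of_def simple_eigenvalues_def)
  have 1: "mset [k. Jordan e' k \<leftarrow> simple_eigenvalues as, e' = e] = {#1#}"
    if "e \<in> Finite ` set as" for e
    using that assms(2) by (induction as) (auto simp: simple_eigenvalues_def)
  have "image_mset (\<lambda>e. mset [k. Jordan e' k \<leftarrow> concat (replicate n (simple_eigenvalues as)), e' = e])
      (mset_set (Finite ` set as)) = image_mset (\<lambda>_. replicate_mset n 1) (mset_set (Finite ` set as))"
    by (rule image_mset_cong) (simp add: mset_concat_map_concat_replicate 1)
  also have "\<dots> = replicate_mset (length as) (replicate_mset n 1)"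
    using assms(2) by (simp add: image_mset_const_eq card_image inj_on_def distinct_card)
  finally show ?thesis
    unfolding type_of_blocks_def e
    by (simp add: mset_concat_map_concat_replicate simple_eigenvalues_def comp_def concat_map_Nil)
qed

text \<open>The map \<open>\<tau>\<close> selects the pencil whose genericity is known: the
  transpose for m < n and m = n, and the identity for m > n, where the given matrices themselves are
  wide. Surjectivity of \<open>\<tau>\<close> keeps the pulled-back open set non-empty.\<close>

lemma has_JK_invariantsI:
  fixes \<tau> :: "complex mat \<Rightarrow> complex mat"
  assumes gen: "generic_pencil (direct_sum (Mat n m) (Mat n m)) p k S"
    and \<tau>: "\<And>A. A \<in> carrier_mat n m \<Longrightarrow> \<tau> A \<in> carrier_mat p k"
    and surj: "\<And>A. A \<in> carrier_mat p k \<Longrightarrow> \<exists>A' \<in> carrier_mat n m. \<tau> A' = A"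
    and poly: "\<And>F. polynomial_matrix (direct_sum (Mat n m) (Mat n m)) n m F \<Longrightarrow>
      polynomial_matrix (direct_sum (Mat n m) (Mat n m)) p k (\<lambda>x. \<tau> (F x))"
    and blocks: "\<And>A B bs. A \<in> carrier_mat n m \<Longrightarrow> B \<in> carrier_mat n m \<Longrightarrow> bs \<in> S \<Longrightarrow>
      pencil_equiv p k (\<tau> A) (\<tau> B) bs \<Longrightarrow>
      \<exists>bs'. pencil_equiv m n (transpose_mat A) (transpose_mat B) bs' \<and>
        (\<forall>b \<in> set bs'. 1 \<le> block_size b) \<and> type_of_blocks (concat (replicate n bs')) = T"
  shows "has_JK_invariants (gl n) (Mat n m) standard_rep_sum T"
proof -
  let ?V = "direct_sum (Mat n m) (Mat n m)"
  have V: "carrier ?V = carrier_mat n m \<times> carrier_mat n m"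
    by (simp add: direct_sum_def module_mat_simps)
  obtain G where G_open: "\<forall>F1 F2. polynomial_matrix ?V p k F1 \<longrightarrow> polynomial_matrix ?V p k F2 \<longrightarrow>
      zariski_open ?V {x \<in> carrier ?V. G (F1 x) (F2 x)}"
    and G_ex: "\<exists>A \<in> carrier_mat p k. \<exists>B \<in> carrier_mat p k. G A B"
    and G_equiv: "\<forall>A \<in> carrier_mat p k. \<forall>B \<in> carrier_mat p k. G A B \<longrightarrow>
      (\<exists>bs \<in> S. pencil_equiv p k A B bs)"
    using gen unfolding generic_pencil_def by (elim exE conjE)
  let ?S = "{x \<in> carrier ?V. G (\<tau> (fst x)) (\<tau> (snd x))}"
  have "zariski_open ?V ?S"
    using G_open poly[OF polynomial_matrix_fst] poly[OF polynomial_matrix_snd] by blast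
  moreover have "?S \<noteq> {}"
  proof -
    obtain A B where "A \<in> carrier_mat n m" "B \<in> carrier_mat n m" "G (\<tau> A) (\<tau> B)"
      using G_ex surj by metis
    then have "(A, B) \<in> ?S" by (simp add: V)
    then show ?thesis by blast
  qed
  moreover have "has_algebraic_type (gl n) (Mat n m) (orbit_map standard_rep_sum A)
      (orbit_map standard_rep_sum B) T" if "(A, B) \<in> ?S" for A B
  proof -
    have AB: "A \<in> carrier_mat n m" "B \<in> carrier_mat n m" "G (\<tau> A) (\<tau> B)"
      using that by (simp_all add: V)
    then obtain bs where "bs \<in> S" "pencil_equiv p k (\<tau> A) (\<tau> B) bs"
      using G_equiv \<tau> by blast
    from blocks[OF AB(1,2) this] obtain bs' where
      "pencil_equiv m n (transpose_mat A) (transpose_mat B) bs'"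
      "\<forall>b \<in> set bs'. 1 \<le> block_size b" "type_of_blocks (concat (replicate n bs')) = T"
      by blast
    then show ?thesis using has_algebraic_type_copies[OF AB(1,2)] by metis
  qed
  ultimately show ?thesis
    unfolding has_JK_invariants_def by (intro exI[of _ ?S]) blast
qed

section \<open>The invariants in the three cases\<close>

lemma JK_horizontal:
  assumes r: "r < d" and m: "m = q * d + r" and n: "n = m + d"
  shows "has_JK_invariants (gl n) (Mat n m) standard_rep_sum
    \<lparr> jordan_sizes = {#},
      horizontal_indices = replicate_mset (n * (d - r)) (q + 1) + replicate_mset (n * r) (q + 2),
      vertical_indices = {#} \<rparr>"
proof -
  obtain e where e: "d = r + e" using r by (metis less_imp_add_positive)
  \<comment> \<open>The d - r widths q + 1 and r widths q + 2 add up to q d + d + r = n columns and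
    q d + r = m rows.\<close>
  define hs where "hs = map ((+) q) (replicate (d - r) 1 @ replicate r 2)"
  have sizes: "height hs = m" "sum_list hs = n"
    using e unfolding m n by (simp_all add: hs_def height_def sum_list_replicate algebra_simps)
  have gen: "generic_pencil (direct_sum (Mat n m) (Mat n m)) m n {map Horizontal hs}"
    using generic_pencil_horizontal[of "replicate (d - r) 1 @ replicate r 2" "direct_sum (Mat n m) (Mat n m)" q]
    unfolding hs_def[symmetric] sizes by (auto simp: set_replicate_conv_if)
  have mset: "repeat_mset n (mset hs) =
      replicate_mset (n * (d - r)) (q + 1) + replicate_mset (n * r) (q + 2)"
    by (rule multiset_eqI) (simp add: hs_def)
  have pos: "\<forall>b \<in> set (map Horizontal hs). 1 \<le> block_size b"
    by (auto simp: hs_def)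
  show ?thesis
  proof (rule has_JK_invariantsI[OF gen, of transpose_mat])
    show "\<exists>A' \<in> carrier_mat n m. transpose_mat A' = A" if "A \<in> carrier_mat m n" for A :: "complex mat"
      using that by (intro bexI[of _ "transpose_mat A"]) auto
    fix A B bs assume "bs \<in> {map Horizontal hs}" "pencil_equiv m n (transpose_mat A) (transpose_mat B) bs"
    then show "\<exists>bs'. pencil_equiv m n (transpose_mat A) (transpose_mat B) bs' \<and>
        (\<forall>b \<in> set bs'. 1 \<le> block_size b) \<and> type_of_blocks (concat (replicate n bs')) =
        \<lparr> jordan_sizes = {#},
          horizontal_indices = replicate_mset (n * (d - r)) (q + 1) + replicate_mset (n * r) (q + 2),
          vertical_indices = {#} \<rparr>"
      using pos mset type_of_blocks_Horizontal[of n hs]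
      by (intro exI[of _ "map Horizontal hs"]) auto
  qed (auto intro!: polynomial_matrix_transpose)
qed

text \<open>The wide pencil is now n x m, so m and n trade places in the division, while the number
  of copies is still n, the number of rows of \<open>Y\<close> in \<open>gl n\<close>.\<close>

lemma JK_vertical:
  assumes r: "r < d" and n: "n = q * d + r" and m: "m = n + d"
  shows "has_JK_invariants (gl n) (Mat n m) standard_rep_sum
    \<lparr> jordan_sizes = {#}, horizontal_indices = {#},
      vertical_indices = replicate_mset (n * (d - r)) (q + 1) + replicate_mset (n * r) (q + 2) \<rparr>"
proof -
  obtain e where e: "d = r + e" using r by (metis less_imp_add_positive)
  define hs where "hs = map ((+) q) (replicate (d - r) 1 @ replicate r 2)"
  have sizes: "height hs = n" "sum_list hs = m"
    using e unfolding m n by (simp_all add: hs_def height_def sum_list_replicate algebra_simps)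
  have gen: "generic_pencil (direct_sum (Mat n m) (Mat n m)) n m {map Horizontal hs}"
    using generic_pencil_horizontal[of "replicate (d - r) 1 @ replicate r 2" "direct_sum (Mat n m) (Mat n m)" q]
    unfolding hs_def[symmetric] sizes by (auto simp: set_replicate_conv_if)
  have mset: "repeat_mset n (mset hs) =
      replicate_mset (n * (d - r)) (q + 1) + replicate_mset (n * r) (q + 2)"
    by (rule multiset_eqI) (simp add: hs_def)
  have pos: "\<forall>b \<in> set (map Vertical hs). 1 \<le> block_size b"
    by (auto simp: hs_def)
  show ?thesis
  proof (rule has_JK_invariantsI[OF gen, of "\<lambda>A. A"])
    fix A B bs assume "A \<in> carrier_mat n m" "B \<in> carrier_mat n m" "bs \<in> {map Horizontal hs}"
      "pencil_equiv n m A B bs"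
    then show "\<exists>bs'. pencil_equiv m n (transpose_mat A) (transpose_mat B) bs' \<and>
        (\<forall>b \<in> set bs'. 1 \<le> block_size b) \<and> type_of_blocks (concat (replicate n bs')) =
        \<lparr> jordan_sizes = {#}, horizontal_indices = {#},
          vertical_indices = replicate_mset (n * (d - r)) (q + 1) + replicate_mset (n * r) (q + 2) \<rparr>"
      using pencil_equiv_transpose pos mset type_of_blocks_Vertical[of n hs]
      by (intro exI[of _ "map Vertical hs"]) auto
  qed auto
qed

lemma JK_square:
  assumes "0 < n"
  shows "has_JK_invariants (gl n) (Mat n n) standard_rep_sum
    \<lparr> jordan_sizes = replicate_mset n (replicate_mset n 1),
      horizontal_indices = {#}, vertical_indices = {#} \<rparr>"
proof (rule has_JK_invariantsI[OF generic_pencil_square, of _ _ transpose_mat])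
  show "\<exists>A' \<in> carrier_mat n n. transpose_mat A' = A" if "A \<in> carrier_mat n n" for A :: "complex mat"
    using that by (intro bexI[of _ "transpose_mat A"]) auto
  fix A B bs assume "bs \<in> {simple_eigenvalues as |as. distinct as \<and> length as = n}"
    "pencil_equiv n n (transpose_mat A) (transpose_mat B) bs"
  then show "\<exists>bs'. pencil_equiv n n (transpose_mat A) (transpose_mat B) bs' \<and>
      (\<forall>b\<in>set bs'. 1 \<le> block_size b) \<and> type_of_blocks (concat (replicate n bs')) =
      \<lparr> jordan_sizes = replicate_mset n (replicate_mset n 1),
        horizontal_indices = {#}, vertical_indices = {#} \<rparr>"
    using type_of_blocks_simple_eigenvalues[OF assms]
    by (intro exI[of _ bs]) (auto simp: simple_eigenvalues_def)
qed (auto intro!: polynomial_matrix_transpose)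

text \<open>A negative quotient would make \<open>int a\<close> at most \<open>r\<close> minus the
  divisor, hence negative; so an integer division of this kind is one of natural numbers.\<close>

lemma int_division_cases:
  assumes eq: "int a = q * (int b - int a) + r" and r: "0 \<le> r" "r < int b - int a"
  obtains q' r' d where "q = int q'" "r = int r'" "d = b - a" "r' < d" "a = q' * d + r'" "b = a + d"
    "int b - int a = int d"
proof -
  define d where "d = b - a"
  have d: "int b - int a = int d" "b = a + d" using r by (auto simp: d_def)
  have "q \<ge> 0"
  proof (rule ccontr)
    assume "\<not> q \<ge> 0"
    then have "q * int d \<le> (-1) * int d" by (intro mult_right_mono) auto
    with eq r d show False by simp
  qed
  then obtain q' r' where qr: "q = int q'" "r = int r'"
    using r by (metis nonneg_int_cases)
  have "int a = int (q' * d + r')" using eq unfolding qr d(1) by simp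
  then have "a = q' * d + r'" by (simp only: of_nat_eq_iff)
  moreover have "r' < d" using r unfolding qr d(1) by simp
  ultimately show thesis using that qr d d_def by blast
qed

theorem theorem3p4:
  fixes m n :: nat
  assumes "0 < m" and "0 < n"
  shows
    "(m < n \<longrightarrow>
        (\<forall>q r :: int. int m = q * (int n - int m) + r \<and> 0 \<le> r \<and> r < int n - int m \<longrightarrow>
           has_JK_invariants (gl n) (Mat n m) standard_rep_sum
             \<lparr> jordan_sizes = {#},
               horizontal_indices =
                 replicate_mset (nat (int n * (int n - int m - r))) (nat (q + 1)) +
                 replicate_mset (nat (int n * r)) (nat (q + 2)),
               vertical_indices = {#} \<rparr>)) \<and>
     (m = n \<longrightarrow>
        has_JK_invariants (gl n) (Mat n m) standard_rep_sum
          \<lparr> jordan_sizes = replicate_mset n (replicate_mset n 1),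
            horizontal_indices = {#},
            vertical_indices = {#} \<rparr>) \<and>
     (n < m \<longrightarrow>
        (\<forall>q r :: int. int n = q * (int m - int n) + r \<and> 0 \<le> r \<and> r < int m - int n \<longrightarrow>
           has_JK_invariants (gl n) (Mat n m) standard_rep_sum
             \<lparr> jordan_sizes = {#},
               horizontal_indices = {#},
               vertical_indices =
                 replicate_mset (nat (int n * (int m - int n - r))) (nat (q + 1)) +
                 replicate_mset (nat (int n * r)) (nat (q + 2)) \<rparr>))"
proof (intro conjI impI allI)
  have nat: "nat (int n * (int d - int r)) = n * (d - r)" "nat (int n * int r) = n * r"
    "nat (int q + 1) = q + 1" "nat (int q + 2) = q + 2" if "r < d" for q r d :: nat
    using that by (simp_all add: nat_mult_distrib nat_diff_distrib')
  {
    fix q r :: int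
    assume "int m = q * (int n - int m) + r \<and> 0 \<le> r \<and> r < int n - int m"
    then obtain q' r' d where *: "q = int q'" "r = int r'" "r' < d" "m = q' * d + r'" "n = m + d"
      "int n - int m = int d"
      using int_division_cases[of m q n r] by metis
    show "has_JK_invariants (gl n) (Mat n m) standard_rep_sum
        \<lparr> jordan_sizes = {#},
          horizontal_indices =
            replicate_mset (nat (int n * (int n - int m - r))) (nat (q + 1)) +
            replicate_mset (nat (int n * r)) (nat (q + 2)),
          vertical_indices = {#} \<rparr>"
      using JK_horizontal[OF *(3-5)] unfolding *(1,2,6) nat[OF *(3)] .
  }
  {
    fix q r :: int
    assume "int n = q * (int m - int n) + r \<and> 0 \<le> r \<and> r < int m - int n"
    then obtain q' r' d where *: "q = int q'" "r = int r'" "r' < d" "n = q' * d + r'" "m = n + d"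
      "int m - int n = int d"
      using int_division_cases[of n q m r] by metis
    show "has_JK_invariants (gl n) (Mat n m) standard_rep_sum
        \<lparr> jordan_sizes = {#},
          horizontal_indices = {#},
          vertical_indices =
            replicate_mset (nat (int n * (int m - int n - r))) (nat (q + 1)) +
            replicate_mset (nat (int n * r)) (nat (q + 2)) \<rparr>"
      using JK_vertical[OF *(3-5)] unfolding *(1,2,6) nat[OF *(3)] .
  }
  assume "m = n"
  then show "has_JK_invariants (gl n) (Mat n m) standard_rep_sum
      \<lparr> jordan_sizes = replicate_mset n (replicate_mset n 1),
        horizontal_indices = {#},
        vertical_indices = {#} \<rparr>"
    using JK_square[OF assms(2)] by simp
qed

end
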